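(* For every integer $n\ge 1$, $$A_n(t,0,q)=\sum_{k=1}^{\lfloor n/2\rfloor}\Bigl(\sum_{\sigma\in\widetilde{\mathfrak{D}}_{n,k}} q^{\mathrm{inv}(\sigma)}\Bigr)\, t^k(1+t)^{n-2k}.$$
   Context: $\mathfrak{S}_n$ is the set of permutations $\sigma=\sigma_1\cdots\sigma_n$ of $[n]$. For $\sigma\in\mathfrak{S}_n$: $\mathrm{exc}(\sigma)=|\{i:\sigma_i>i\}|$, $\mathrm{fix}(\sigma)=|\{i:\sigma_i=i\}|$, $\mathrm{maj}(\sigma)=\sum_{i:\sigma_i>\sigma_{i+1}} i$, $\mathrm{des}(\sigma)=|\{i\in[n-1]:\sigma_i>\sigma_{i+1}\}|$, $\mathrm{inv}(\sigma)=|\{(i,j):i<j,\ \sigma_i>\sigma_j\}|$. $A_n(t,r,q)=\sum_{\sigma\in\mathfrak{S}_n} t^{\mathrm{exc}(\sigma)}r^{\mathrm{fix}(\sigma)}q^{\mathrm{maj}(\sigma)-\mathrm{exc}(\sigma)}$ (so $A_n(t,0,q)$ sums over derangements). With $\sigma_0=\sigma_{n+1}=+\infty$, $\sigma_i$ is a double descent if $\sigma_{i-1}>\sigma_i>\sigma_{i+1}$; $\mathrm{dd}(\sigma)$ counts them. $\mathfrak{D}_{n,k}=\{\sigma\in\mathfrak{S}_n:\mathrm{dd}(\sigma)=0,\ \mathrm{des}(\sigma)=k\}$ and $\widetilde{\mathfrak{D}}_{n,k}=\{\sigma\in\mathfrak{D}_{n,k-1}:\sigma_{n-1}<\sigma_n\}$.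 *)

theory Defs
  imports Complex_Main "HOL-Combinatorics.Permutations" "HOL-Library.Extended_Nat"
begin

text \<open>
  A permutation \<open>\<sigma>\<^sub>1\<dots>\<sigma>\<^sub>n\<close> of \<open>[n]\<close> is a function \<^term>\<open>\<sigma>\<close> with \<^prop>\<open>\<sigma> permutes {1..n}\<close>,
  so positions and letters both start at 1.
\<close>

definition perm_exc :: "nat \<Rightarrow> (nat \<Rightarrow> nat) \<Rightarrow> nat" where
  "perm_exc n \<sigma> = card {i \<in> {1..n}. \<sigma> i > i}"

definition perm_fix :: "nat \<Rightarrow> (nat \<Rightarrow> nat) \<Rightarrow> nat" where
  "perm_fix n \<sigma> = card {i \<in> {1..n}. \<sigma> i = i}"

definition perm_maj :: "nat \<Rightarrow> (nat \<Rightarrow> nat) \<Rightarrow> nat" where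
  "perm_maj n \<sigma> = (\<Sum>i | i \<in> {1..<n} \<and> \<sigma> i > \<sigma> (i + 1). i)"

definition perm_des :: "nat \<Rightarrow> (nat \<Rightarrow> nat) \<Rightarrow> nat" where
  "perm_des n \<sigma> = card {i \<in> {1..<n}. \<sigma> i > \<sigma> (i + 1)}"

definition perm_inv :: "nat \<Rightarrow> (nat \<Rightarrow> nat) \<Rightarrow> nat" where
  "perm_inv n \<sigma> = card {(i, j). i \<in> {1..n} \<and> j \<in> {1..n} \<and> i < j \<and> \<sigma> i > \<sigma> j}"

text \<open>
  The word with the boundary convention \<open>\<sigma>\<^sub>0 = \<sigma>\<^sub>n\<^sub>+\<^sub>1 = \<infinity>\<close>; the values of \<^term>\<open>\<sigma>\<close> outside
  \<open>{1..n}\<close> are ignored.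
\<close>

definition perm_letter :: "nat \<Rightarrow> (nat \<Rightarrow> nat) \<Rightarrow> nat \<Rightarrow> enat" where
  "perm_letter n \<sigma> i = (if i \<in> {1..n} then enat (\<sigma> i) else \<infinity>)"

definition perm_dd :: "nat \<Rightarrow> (nat \<Rightarrow> nat) \<Rightarrow> nat" where
  "perm_dd n \<sigma> = card {i \<in> {1..n}.
     perm_letter n \<sigma> (i - 1) > perm_letter n \<sigma> i \<and> perm_letter n \<sigma> i > perm_letter n \<sigma> (i + 1)}"

definition D_set :: "nat \<Rightarrow> nat \<Rightarrow> (nat \<Rightarrow> nat) set" where
  "D_set n k = {\<sigma>. \<sigma> permutes {1..n} \<and> perm_dd n \<sigma> = 0 \<and> perm_des n \<sigma> = k}"

text \<open>Only meaningful for \<open>k \<ge> 1\<close> and \<open>n \<ge> 2\<close>.\<close>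

definition D_tilde_set :: "nat \<Rightarrow> nat \<Rightarrow> (nat \<Rightarrow> nat) set" where
  "D_tilde_set n k = {\<sigma> \<in> D_set n (k - 1). \<sigma> (n - 1) < \<sigma> n}"

text \<open>
  Evaluation of \<open>A\<^sub>n(t,r,q)\<close> at elements of an arbitrary commutative ring; taking the
  indeterminates of a polynomial ring for \<open>t\<close>, \<open>r\<close>, \<open>q\<close> gives the formal polynomial. The
  subtraction of natural numbers in the exponent is exact by \<open>perm_exc_le_perm_maj\<close> below.
\<close>

definition eulerian_A :: "nat \<Rightarrow> 'a \<Rightarrow> 'a \<Rightarrow> 'a \<Rightarrow> 'a :: comm_ring_1" where
  "eulerian_A n t r q =
     (\<Sum>\<sigma> | \<sigma> permutes {1..n}. t ^ perm_exc n \<sigma> * r ^ perm_fix n \<sigma> * q ^ (perm_maj n \<sigma> - perm_exc n \<sigma>))"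

text \<open>All excedances lie weakly to the left of the last descent, as the word increases after it.\<close>

lemma perm_exc_le_perm_maj:
  assumes perm: "\<sigma> permutes {1..n}"
  shows "perm_exc n \<sigma> \<le> perm_maj n \<sigma>"
proof -
  define S where "S = {i. i \<in> {1..<n} \<and> \<sigma> i > \<sigma> (i + 1)}"
  have maj: "perm_maj n \<sigma> = \<Sum>S"
    by (simp add: perm_maj_def S_def)
  have fin: "finite S" by (simp add: S_def)
  have le: "i \<le> \<Sum>S" if "i \<in> {1..n}" "\<sigma> i > i" for i
  proof (rule ccontr)
    assume "\<not> i \<le> \<Sum>S"
    hence small: "\<Sum>S < i" by simp
    have noS: "j \<notin> S" if "j \<ge> i" for j
    proof
      assume "j \<in> S"
      hence "j \<le> \<Sum>S" using fin by (intro member_le_sum) simp_all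
      thus False using small that by linarith
    qed
    have inc: "\<sigma> j < \<sigma> (Suc j)" if "j \<ge> i" "j < n" for j
    proof -
      have "\<sigma> j \<le> \<sigma> (Suc j)"
        using noS[OF that(1)] that \<open>i \<in> {1..n}\<close> by (simp add: S_def)
      moreover have "\<sigma> j \<noteq> \<sigma> (Suc j)"
        by (simp add: inj_eq[OF permutes_inj[OF perm]])
      ultimately show ?thesis by simp
    qed
    have "i \<le> n" using that by simp
    hence "\<sigma> n > n"
    proof (induction rule: dec_induct)
      case base
      show ?case by (rule that(2))
    next
      case (step j)
      thus ?case using inc[of j] by simp
    qed
    moreover have "\<sigma> n \<in> {1..n}"
      using permutes_in_image[OF perm, of n] that by simp
    ultimately show False by simp
  qed
  have "{i \<in> {1..n}. \<sigma> i > i} \<subseteq> {1..\<Sum>S}" using le by auto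
  from card_mono[OF _ this] show ?thesis
    by (simp add: perm_exc_def maj)
qed

end

theory Submission
  imports Defs "HOL-Combinatorics.Multiset_Permutations" "HOL-Computational_Algebra.Formal_Power_Series"
begin

text \<open>
  Both sides of the identity satisfy the recurrence
  \<open>\<Sum>m\<le>n. [n choose m]\<^sub>q (t^m - t) X\<^sub>n\<^sub>-\<^sub>m = 0\<close> for \<open>n \<ge> 1\<close> with \<open>X\<^sub>0 = 1\<close>, which determines \<open>X\<close> when \<open>t \<noteq> 1\<close>.

  On the side of \<open>D_tilde_set\<close>, the permutations in question are those whose maximal increasing runs
  all have length at least two. Cutting an increasing prefix off a permutation produces the Gaussian
  binomial coefficient, and the alternating sum over all increasing prefixes vanishes permutation
  by permutation.

  On the side of derangements, \<open>maj - exc\<close> is the sum of a modified descent set (Shareshian and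
  Wachs), so \<open>q^(maj - exc) / ((1 - q) \<cdots> (1 - q^n))\<close> enumerates chains that are strict on this set.
  Pairs of a derangement and a chain correspond to words in two kinds of letters, an excedance letter
  being bounded from below and the other ones from above by the number of smaller letters. Inclusion and
  exclusion on the lower bounds leaves only nested upper bounds, for which the words with a given
  content are counted by a product of binomial coefficients; summing over the contents gives
  \<open>(1 - t) / (e(t z) - t e(z))\<close> with \<open>e(z) = \<Prod>b. 1 / (1 - x\<^sub>b z)\<close>.

  The chain argument lets the number of letters tend to infinity with \<open>x\<^sub>b = q^b\<close> and
  therefore takes place over the reals; the identity of polynomials is then transferred to an arbitrary
  commutative ring.
\<close>

text \<open>The two recurrences meet as follows. Let F_k be the coefficient of z^k in (1 - t) / (e(t
  z) - t e(z)). Comparing coefficients of z^n after clearing the denominator gives a sum of (t^m -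
  t) e_m F_(n-m) equal to 0, and e_m tends to 1 / (q; q)_m while F_k tends to A_k / (q; q)_k. The
  formula for F is exact for every finite number N of chain values; only the passage to the limit
  needs 0 < q < 1. A chain value b is given the weight q^(N - 1 - b) rather than q^b, because a
  strict step at i then pushes the first i values down and costs exactly q^i.

  The obstacle on the side of derangements is that lower and upper bounds do not nest, so the room
  left for one letter depends on where the others stand. If all bounds are upper bounds that grow
  with the letter, the positions filled so far lie inside the next bound and only their number
  matters.\<close>

section \<open>Increasing runs and inversions\<close>

text \<open>
  The weight is \<open>t^r (1 + t)^(n - 2 r)\<close> if the word of length \<open>n\<close> has \<open>r\<close> increasing runs, all of length
  at least two, and \<open>0\<close> otherwise. In \<open>open_run_weight\<close> the first letter already has a smaller
  predecessor in its run.
\<close>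

fun run_weight :: "'a::comm_ring_1 \<Rightarrow> nat list \<Rightarrow> 'a"
  and open_run_weight :: "'a::comm_ring_1 \<Rightarrow> nat list \<Rightarrow> 'a" where
  "run_weight t [] = 1"
| "run_weight t [x] = 0"
| "run_weight t (x # y # zs) = (if x < y then t * open_run_weight t (y # zs) else 0)"
| "open_run_weight t [] = 1"
| "open_run_weight t [y] = 1"
| "open_run_weight t (y # z # zs) =
     (if y < z then (1 + t) * open_run_weight t (z # zs) else run_weight t (z # zs))"

text \<open>Removing the first letter turns \<open>a\<close> into \<open>a * t\<close>, hence the
  free coefficients in the induction. At an ascent the terms add up to (a + b) t + (a t^2 + b) = (a
  t + b) (1 + t), the factor in \<open>open_run_weight\<close>; at a descent only the prefixes of
  length 0 and 1 are increasing. For a = 1 and b = - t the right side vanishes.\<close>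

lemma sum_increasing_prefixes:
  fixes t a b :: "'a::comm_ring_1"
  assumes "zs \<noteq> []"
  shows "(\<Sum>m\<le>length zs. if sorted_wrt (<) (take m zs) then (a * t ^ m + b) * run_weight t (drop m zs) else 0)
    = (a * t + b) * open_run_weight t zs"
  using assms
proof (induction zs arbitrary: a)
  case Nil
  then show ?case by simp
next
  case (Cons y zs)
  show ?case
  proof (cases zs)
    case Nil
    then show ?thesis by simp
  next
    case (Cons z ws)
    let ?f = "\<lambda>a xs m. if sorted_wrt (<) (take m xs) then (a * t ^ m + b) * run_weight t (drop m xs) else 0"
    have split: "(\<Sum>m\<le>length (y # zs). ?f a (y # zs) m)
        = (a + b) * run_weight t (y # zs) + (\<Sum>m\<le>length zs. ?f a (y # zs) (Suc m))"
      by (simp only: length_Cons sum.atMost_Suc_shift) simp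
    show ?thesis
    proof (cases "y < z")
      case True
      have "?f a (y # zs) (Suc m) = ?f (a * t) zs m" for m
        using True Cons by (cases m) (auto simp: algebra_simps)
      hence "(\<Sum>m\<le>length zs. ?f a (y # zs) (Suc m)) = (a * t * t + b) * open_run_weight t zs"
        using Cons.IH[of "a * t"] Cons by simp
      then show ?thesis using split True Cons by (simp add: algebra_simps)
    next
      case False
      have "?f a (y # zs) (Suc m) = (if m = 0 then (a * t + b) * run_weight t zs else 0)" for m
        using False Cons by (cases m) (auto simp: algebra_simps)
      then show ?thesis using split False Cons by simp
    qed
  qed
qed

section \<open>Inversions, Gaussian binomial coefficients and the recurrence\<close>

fun list_inv :: "nat list \<Rightarrow> nat" where
  "list_inv [] = 0"
| "list_inv (x # xs) = card {y \<in> set xs. y < x} + list_inv xs"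

definition cross_inv :: "nat set \<Rightarrow> nat set \<Rightarrow> nat" where
  "cross_inv A B = (\<Sum>a\<in>A. card {b \<in> B. b < a})"

lemma list_inv_append_increasing:
  assumes "sorted_wrt (<) us"
  shows "list_inv (us @ ys) = cross_inv (set us) (set ys) + list_inv ys"
  using assms
proof (induction us)
  case Nil
  then show ?case by (simp add: cross_inv_def)
next
  case (Cons u us)
  have "{y \<in> set (us @ ys). y < u} = {y \<in> set ys. y < u}" using Cons.prems by auto
  moreover have "u \<notin> set us" using Cons.prems by auto
  ultimately show ?case using Cons by (simp add: cross_inv_def)
qed

definition run_sum :: "'a::comm_ring_1 \<Rightarrow> 'a \<Rightarrow> nat set \<Rightarrow> 'a" where
  "run_sum t q A = (\<Sum>zs\<in>permutations_of_set A. q ^ list_inv zs * run_weight t zs)"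

lemma run_sum_empty: "run_sum t q {} = 1"
  by (simp add: run_sum_def)

text \<open>A subset S together with an arrangement of \<open>A - S\<close> is a word on
  \<open>A\<close> with a marked increasing prefix: S is written in increasing order in front and
  has no inversions of its own. After exchanging the sums, \<open>sum_increasing_prefixes\<close>
  makes the contribution of each word vanish.\<close>

lemma run_sum_recurrence:
  fixes t q :: "'a::comm_ring_1"
  assumes "finite A" "A \<noteq> {}"
  shows "(\<Sum>S\<in>Pow A. (t ^ card S - t) * q ^ cross_inv S (A - S) * run_sum t q (A - S)) = 0"
proof -
  let ?L = "sorted_list_of_set"
  let ?X = "Sigma (Pow A) (\<lambda>S. permutations_of_set (A - S))"
  let ?Y = "Sigma (permutations_of_set A) (\<lambda>zs. {m \<in> {..length zs}. sorted_wrt (<) (take m zs)})"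
  have fin: "finite S" if "S \<in> Pow A" for S using that assms finite_subset by auto
  have "(\<Sum>S\<in>Pow A. (t ^ card S - t) * q ^ cross_inv S (A - S) * run_sum t q (A - S))
     = (\<Sum>S\<in>Pow A. \<Sum>ys\<in>permutations_of_set (A - S). (t ^ card S - t) * q ^ cross_inv S (A - S) * (q ^ list_inv ys * run_weight t ys))"
    by (simp add: run_sum_def sum_distrib_left)
  also have "\<dots> = (\<Sum>(S, ys)\<in>?X. (t ^ card S - t) * q ^ cross_inv S (A - S) * (q ^ list_inv ys * run_weight t ys))"
    by (rule sum.Sigma) (use assms in auto)
  also have "\<dots> = (\<Sum>(zs, m)\<in>?Y. q ^ list_inv zs * ((t ^ m - t) * run_weight t (drop m zs)))"
  proof (rule sum.reindex_bij_witness[where j = "\<lambda>(S, ys). (?L S @ ys, card S)" and i = "\<lambda>(zs, m). (set (take m zs), drop m zs)"])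
    fix p assume "p \<in> ?X"
    then obtain S ys where p: "p = (S, ys)" "S \<in> Pow A" "set ys = A - S" "distinct ys"
      by (auto simp: permutations_of_set_def)
    note fS = fin[OF p(2)]
    show "(case case p of (S, ys) \<Rightarrow> (?L S @ ys, card S) of (zs, m) \<Rightarrow> (set (take m zs), drop m zs)) = p"
      using p fS by simp
    show "(case p of (S, ys) \<Rightarrow> (?L S @ ys, card S)) \<in> ?Y"
      using p fS by (auto simp: permutations_of_set_def)
    have "list_inv (?L S @ ys) = cross_inv S (A - S) + list_inv ys"
      using list_inv_append_increasing[of "?L S" ys] p fS by simp
    then show "(case case p of (S, ys) \<Rightarrow> (?L S @ ys, card S) of (zs, m) \<Rightarrow> q ^ list_inv zs * ((t ^ m - t) * run_weight t (drop m zs))) =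
         (case p of (S, ys) \<Rightarrow> (t ^ card S - t) * q ^ cross_inv S (A - S) * (q ^ list_inv ys * run_weight t ys))"
      using p fS by (simp add: power_add algebra_simps)
  next
    fix p assume "p \<in> ?Y"
    then obtain zs m where p: "p = (zs, m)" "set zs = A" "distinct zs" "m \<le> length zs" "sorted_wrt (<) (take m zs)"
      by (auto simp: permutations_of_set_def)
    have 1: "?L (set (take m zs)) = take m zs"
      using p by (simp add: sorted_list_of_set.idem_if_sorted_distinct strict_sorted_iff)
    have 2: "card (set (take m zs)) = m" using p by (simp add: distinct_card)
    have "set zs = set (take m zs) \<union> set (drop m zs)" by (metis append_take_drop_id set_append)
    moreover have "set (take m zs) \<inter> set (drop m zs) = {}" using p set_take_disj_set_drop_if_distinct by blast
    ultimately have 3: "set (drop m zs) = A - set (take m zs)" using p by auto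
    show "(case case p of (zs, m) \<Rightarrow> (set (take m zs), drop m zs) of (S, ys) \<Rightarrow> (?L S @ ys, card S)) = p"
      using p 1 2 by simp
    show "(case p of (zs, m) \<Rightarrow> (set (take m zs), drop m zs)) \<in> ?X"
      using p 3 by (simp add: permutations_of_set_def) (use set_take_subset[of m zs] in blast)
  qed
  also have "\<dots> = (\<Sum>zs\<in>permutations_of_set A. \<Sum>m\<in>{m \<in> {..length zs}. sorted_wrt (<) (take m zs)}.
       q ^ list_inv zs * ((t ^ m - t) * run_weight t (drop m zs)))"
    by (rule sum.Sigma[symmetric]) (use assms in auto)
  also have "\<dots> = (\<Sum>zs\<in>permutations_of_set A. q ^ list_inv zs * (\<Sum>m\<le>length zs.
      if sorted_wrt (<) (take m zs) then (1 * t ^ m + (- t)) * run_weight t (drop m zs) else 0))"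
  proof (rule sum.cong[OF refl])
    fix zs
    have "(\<Sum>m\<in>{m \<in> {..length zs}. sorted_wrt (<) (take m zs)}. q ^ list_inv zs * ((t ^ m - t) * run_weight t (drop m zs)))
      = q ^ list_inv zs * (\<Sum>m\<in>{m \<in> {..length zs}. sorted_wrt (<) (take m zs)}. (1 * t ^ m + (- t)) * run_weight t (drop m zs))"
      by (simp add: sum_distrib_left)
    then show "(\<Sum>m\<in>{m \<in> {..length zs}. sorted_wrt (<) (take m zs)}. q ^ list_inv zs * ((t ^ m - t) * run_weight t (drop m zs)))
      = q ^ list_inv zs * (\<Sum>m\<le>length zs. if sorted_wrt (<) (take m zs) then (1 * t ^ m + (- t)) * run_weight t (drop m zs) else 0)"
      by (subst sum.inter_filter[symmetric]) simp_all
  qed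
  also have "\<dots> = 0"
  proof (rule sum.neutral, rule ballI)
    fix zs assume "zs \<in> permutations_of_set A"
    hence "zs \<noteq> []" using assms by (auto simp: permutations_of_set_def)
    from sum_increasing_prefixes[OF this, of 1 t "- t"]
    show "q ^ list_inv zs * (\<Sum>m\<le>length zs.
      if sorted_wrt (<) (take m zs) then (1 * t ^ m + (- t)) * run_weight t (drop m zs) else 0) = 0" by simp
  qed
  finally show ?thesis .
qed

text \<open>
  This is \<open>(q; q)\<^sub>n\<close>, that is, \<open>(1 - q)^n\<close> times the usual \<open>q\<close>-factorial.
\<close>

definition q_fact :: "'a::comm_ring_1 \<Rightarrow> nat \<Rightarrow> 'a" where
  "q_fact q n = (\<Prod>i=1..n. 1 - q ^ i)"

lemma q_fact_0 [simp]: "q_fact q 0 = 1" and q_fact_Suc: "q_fact q (Suc n) = q_fact q n * (1 - q ^ Suc n)"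
  by (simp_all add: q_fact_def)

text \<open>Induction on the largest element b is the q-Pascal rule: outside S, b takes part in no
  inversion; inside S, it is inverted with all \<open>card A - card S\<close> elements left outside.
  The denominators of the Gaussian binomial coefficient are multiplied out so that no division in
  the ring is involved.\<close>

lemma sum_cross_inv_subsets:
  fixes q :: "'a::comm_ring_1"
  assumes "finite A" "m \<le> card A"
  shows "(\<Sum>S | S \<subseteq> A \<and> card S = m. q ^ cross_inv S (A - S)) * (q_fact q m * q_fact q (card A - m)) = q_fact q (card A)"
  using assms
proof (induction A arbitrary: m rule: finite_linorder_max_induct)
  case empty
  have *: "{S. S \<subseteq> {} \<and> card S = m} = {{}}" using empty by auto
  show ?case unfolding * using empty by (simp add: cross_inv_def)
next
  case (insert b A)
  let ?g = "\<lambda>A m. (\<Sum>S | S \<subseteq> A \<and> card S = m. q ^ cross_inv S (A - S))"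
  have bA: "b \<notin> A" using insert by auto
  have fS: "finite S" if "S \<subseteq> A" for S using that insert.hyps(1) by (rule finite_subset)
  have less: "\<not> b < a" if "a \<in> A" for a using insert.hyps that by fastforce
  have without: "cross_inv S (insert b A - S) = cross_inv S (A - S)" if "S \<subseteq> A" for S
    unfolding cross_inv_def
  proof (rule sum.cong[OF refl])
    fix a assume "a \<in> S"
    then have "{x \<in> insert b A - S. x < a} = {x \<in> A - S. x < a}" using less that by blast
    then show "card {x \<in> insert b A - S. x < a} = card {x \<in> A - S. x < a}" by simp
  qed
  have with_b: "cross_inv (insert b S) (insert b A - insert b S) = cross_inv S (A - S) + (card A - card S)" if "S \<subseteq> A" for S
  proof -
    have 1: "insert b A - insert b S = A - S" using bA that by auto
    have 2: "b \<notin> S" using bA that by auto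
    have "{x \<in> A - S. x < b} = A - S" using insert.hyps by auto
    then show ?thesis unfolding 1 using 2 fS[OF that] insert.hyps that
      by (simp add: cross_inv_def card_Diff_subset)
  qed
  have fin1: "finite {S. S \<subseteq> A \<and> P S}" for P using insert by simp
  define n where "n = card A"
  show ?case
  proof (cases m)
    case 0
    have "{S. S \<subseteq> insert b A \<and> card S = 0} = {{}}" using insert by (auto dest: finite_subset)
    then show ?thesis using 0 by (simp add: cross_inv_def)
  next
    case (Suc k)
    have dec: "{S. S \<subseteq> insert b A \<and> card S = m} = {S. S \<subseteq> A \<and> card S = m} \<union> insert b ` {S. S \<subseteq> A \<and> card S = k}"
    proof (intro equalityI subsetI)
      fix S assume S: "S \<in> {S. S \<subseteq> insert b A \<and> card S = m}"
      show "S \<in> {S. S \<subseteq> A \<and> card S = m} \<union> insert b ` {S. S \<subseteq> A \<and> card S = k}"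
      proof (cases "b \<in> S")
        case True
        then have "S = insert b (S - {b})" by auto
        moreover have "S - {b} \<subseteq> A" using S by auto
        moreover have "card (S - {b}) = k" using S True Suc by simp
        ultimately show ?thesis by blast
      qed (use S in auto)
    next
      fix S assume "S \<in> {S. S \<subseteq> A \<and> card S = m} \<union> insert b ` {S. S \<subseteq> A \<and> card S = k}"
      then show "S \<in> {S. S \<subseteq> insert b A \<and> card S = m}"
        using bA fS Suc by (auto simp: card_insert_if subset_iff)
    qed
    have inj: "inj_on (insert b) {S. S \<subseteq> A \<and> card S = k}"
      using bA by (auto intro!: inj_onI simp: insert_ident subset_iff)
    have "?g (insert b A) m = (\<Sum>S | S \<subseteq> A \<and> card S = m. q ^ cross_inv S (insert b A - S))
       + (\<Sum>S | S \<subseteq> A \<and> card S = k. q ^ cross_inv (insert b S) (insert b A - insert b S))"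
      unfolding dec by (subst sum.union_disjoint) (use bA fin1 in \<open>auto simp: sum.reindex[OF inj]\<close>)
    also have "\<dots> = ?g A m + (\<Sum>S | S \<subseteq> A \<and> card S = k. q ^ (n - k) * q ^ cross_inv S (A - S))"
    proof (intro arg_cong2[where f = "(+)"] sum.cong refl)
      fix S assume "S \<in> {S. S \<subseteq> A \<and> card S = m}"
      then show "q ^ cross_inv S (insert b A - S) = q ^ cross_inv S (A - S)" using without[of S] by simp
    next
      fix S assume "S \<in> {S. S \<subseteq> A \<and> card S = k}"
      then have "cross_inv (insert b S) (insert b A - insert b S) = cross_inv S (A - S) + (n - k)"
        using with_b[of S] n_def by blast
      then show "q ^ cross_inv (insert b S) (insert b A - insert b S) = q ^ (n - k) * q ^ cross_inv S (A - S)"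
        by (simp only: power_add mult.commute)
    qed
    finally have g: "?g (insert b A) m = ?g A m + q ^ (n - k) * ?g A k"
      by (simp add: sum_distrib_left)
    have cA: "card (insert b A) = Suc n" using insert bA n_def by simp
    have k: "k \<le> n" using insert.prems Suc cA by simp
    have IHk: "?g A k * (q_fact q k * q_fact q (n - k)) = q_fact q n"
      using insert.IH[of k] k n_def by simp
    have e1: "?g A m * (q_fact q m * q_fact q (n - k)) = q_fact q n * (1 - q ^ (n - k))"
    proof (cases "k = n")
      case True
      have "card S \<noteq> m" if "S \<subseteq> A" for S
        using card_mono[OF insert.hyps(1) that] True Suc n_def by simp
      then have none: "{S. S \<subseteq> A \<and> card S = m} = {}" by blast
      show ?thesis unfolding none using True by simp
    next
      case False
      then obtain r where r: "n - k = Suc r" using k by (metis Suc_diff_Suc le_neq_implies_less)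
      have "n - m = r" using r Suc by simp
      then have *: "?g A m * (q_fact q m * q_fact q r) = q_fact q n"
        using insert.IH[of m] r Suc n_def by simp
      show ?thesis unfolding r q_fact_Suc *[symmetric] by (simp only: mult.assoc)
    qed
    have e2: "q ^ (n - k) * ?g A k * (q_fact q m * q_fact q (n - k)) = q_fact q n * (q ^ (n - k) * (1 - q ^ m))"
      unfolding Suc q_fact_Suc IHk[symmetric] by (simp add: algebra_simps)
    have "n - k + m = Suc n" using k Suc by simp
    then have "q ^ (n - k) * q ^ m = q ^ Suc n" by (metis power_add)
    then have "q_fact q n * (1 - q ^ (n - k)) + q_fact q n * (q ^ (n - k) * (1 - q ^ m)) = q_fact q (Suc n)"
      by (simp add: q_fact_Suc algebra_simps)
    moreover have "card (insert b A) - m = n - k" using cA Suc by simp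
    ultimately show ?thesis unfolding cA g using e1 e2 by (simp add: distrib_right Suc cA)
  qed
qed

lemma run_sum_unique:
  fixes t q :: real and d :: "nat \<Rightarrow> real"
  assumes "t \<noteq> 1" and q: "\<And>n. q_fact q n \<noteq> 0" and d0: "d 0 = 1"
    and rec: "\<And>n. n \<ge> 1 \<Longrightarrow> (\<Sum>m\<le>n. (t ^ m - t) * d (n - m) / (q_fact q m * q_fact q (n - m))) = 0"
    and "finite A"
  shows "run_sum t q A = d (card A)"
  using \<open>finite A\<close>
proof (induction "card A" arbitrary: A rule: less_induct)
  case (less A)
  show ?case
  proof (cases "A = {}")
    case True
    then show ?thesis using d0 by (simp add: run_sum_empty)
  next
    case False
    define n where "n = card A"
    have n: "n \<ge> 1" using False less.prems n_def by (simp add: card_gt_0_iff Suc_le_eq)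
    \<comment> \<open>By induction the sums over proper subsets depend on the cardinality only. The
      term m = 0 still contains the unknown \<open>run_sum t q A\<close>; comparing with the
      recurrence for \<open>d\<close> isolates it with the factor 1 - t.\<close>
    define r where "r = (\<lambda>m. if m = 0 then run_sum t q A else d (n - m))"
    have r: "run_sum t q (A - S) = r (card S)" if "S \<in> Pow A" for S
    proof (cases "S = {}")
      case False
      have f: "finite S" using that less finite_subset by auto
      have c: "card S > 0" using False f by (simp add: card_gt_0_iff)
      have "card S \<le> card A" using that less card_mono by auto
      then have "card (A - S) = n - card S" "card (A - S) < card A"
        using that f c n_def by (auto simp: card_Diff_subset)
      then show ?thesis using less.hyps[of "A - S"] less.prems c by (auto simp: r_def)
    qed (simp add: r_def)
    have "0 = (\<Sum>S\<in>Pow A. (t ^ card S - t) * q ^ cross_inv S (A - S) * run_sum t q (A - S))"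
      using run_sum_recurrence[OF less.prems False] by simp
    also have "\<dots> = (\<Sum>S\<in>Pow A. (t ^ card S - t) * q ^ cross_inv S (A - S) * r (card S))"
      using r by (intro sum.cong) auto
    also have "\<dots> = (\<Sum>m\<le>n. \<Sum>S\<in>{S \<in> Pow A. card S = m}. (t ^ card S - t) * q ^ cross_inv S (A - S) * r (card S))"
      by (rule sum.group[symmetric]) (use less.prems in \<open>auto simp: n_def intro: card_mono\<close>)
    also have "\<dots> = (\<Sum>m\<le>n. (t ^ m - t) * r m * (\<Sum>S | S \<subseteq> A \<and> card S = m. q ^ cross_inv S (A - S)))"
      by (intro sum.cong refl) (auto simp: sum_distrib_left intro!: sum.cong)
    also have "\<dots> = (\<Sum>m\<le>n. q_fact q n * ((t ^ m - t) * r m / (q_fact q m * q_fact q (n - m))))"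
    proof (intro sum.cong refl)
      fix m assume "m \<in> {..n}"
      then have "(\<Sum>S | S \<subseteq> A \<and> card S = m. q ^ cross_inv S (A - S)) * (q_fact q m * q_fact q (n - m)) = q_fact q n"
        using sum_cross_inv_subsets[OF less.prems, of m q] n_def by simp
      then have "(\<Sum>S | S \<subseteq> A \<and> card S = m. q ^ cross_inv S (A - S)) = q_fact q n / (q_fact q m * q_fact q (n - m))"
        using q by (simp add: field_simps)
      then show "(t ^ m - t) * r m * (\<Sum>S | S \<subseteq> A \<and> card S = m. q ^ cross_inv S (A - S)) =
         q_fact q n * ((t ^ m - t) * r m / (q_fact q m * q_fact q (n - m)))" by simp
    qed
    finally have "(\<Sum>m\<le>n. (t ^ m - t) * r m / (q_fact q m * q_fact q (n - m))) = 0"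
      using q[of n] unfolding sum_distrib_left[symmetric] by simp
    with rec[OF n] have "(\<Sum>m\<le>n. (t ^ m - t) * r m / (q_fact q m * q_fact q (n - m)))
       = (\<Sum>m\<le>n. (t ^ m - t) * d (n - m) / (q_fact q m * q_fact q (n - m)))" by simp
    then have "(1 - t) * r 0 / q_fact q n = (1 - t) * d n / q_fact q n"
      by (simp add: sum.atMost_shift r_def)
    then show ?thesis using q[of n] \<open>t \<noteq> 1\<close> by (simp add: r_def n_def)
  qed
qed

section \<open>From arrangements of \<open>{1..n}\<close> back to permutations\<close>

lemma bij_betw_permutes_permutations_of_set:
  "bij_betw (\<lambda>\<sigma>. map \<sigma> [1..<Suc n]) {\<sigma>. \<sigma> permutes {1..n}} (permutations_of_set {1..n})"
proof -
  let ?f = "\<lambda>\<sigma>. map \<sigma> [1..<Suc n]"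
  have inj: "inj_on ?f {\<sigma>. \<sigma> permutes {1..n}}"
  proof (rule inj_onI)
    fix \<sigma> \<tau> assume a: "\<sigma> \<in> {\<sigma>. \<sigma> permutes {1..n}}" "\<tau> \<in> {\<sigma>. \<sigma> permutes {1..n}}" "?f \<sigma> = ?f \<tau>"
    have "\<sigma> i = \<tau> i" for i
    proof (cases "i \<in> {1..n}")
      case True
      then have "i \<in> set [1..<Suc n]" by auto
      then show ?thesis using a(3) by (simp only: map_eq_conv)
    next
      case False
      then show ?thesis using a by (auto simp: permutes_def)
    qed
    then show "\<sigma> = \<tau>" by blast
  qed
  have set_eq: "set [1..<Suc n] = {1..n}" by auto
  have "?f ` {\<sigma>. \<sigma> permutes {1..n}} \<subseteq> permutations_of_set {1..n}"
  proof safe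
    fix \<sigma> assume \<sigma>: "\<sigma> permutes {1..n}"
    have "set (?f \<sigma>) = {1..n}" using permutes_image[OF \<sigma>] set_eq by (metis set_map)
    moreover have "distinct (?f \<sigma>)" unfolding distinct_map using permutes_inj_on[OF \<sigma>] by simp
    ultimately show "?f \<sigma> \<in> permutations_of_set {1..n}" by (simp only: permutations_of_set_def) blast
  qed
  moreover have "card (?f ` {\<sigma>. \<sigma> permutes {1..n}}) = card (permutations_of_set {1..n})"
    using card_image[OF inj] card_permutations[of "{1..n}" n] by simp
  ultimately have "?f ` {\<sigma>. \<sigma> permutes {1..n}} = permutations_of_set {1..n}"
    by (intro card_subset_eq) auto
  with inj show ?thesis by (rule bij_betw_imageI)
qed

lemma list_inv_map_permutes:
  assumes \<sigma>: "\<sigma> permutes {1..n}"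
  shows "list_inv (map \<sigma> [1..<Suc n]) = perm_inv n \<sigma>"
proof -
  have suffix: "list_inv (map \<sigma> [i..<Suc n]) = (\<Sum>a=i..n. card {b \<in> {Suc a..n}. \<sigma> b < \<sigma> a})" if "i \<le> Suc n" for i
    using that
  proof (induction rule: inc_induct)
    case base
    show ?case by simp
  next
    case (step i)
    have "{y \<in> set (map \<sigma> [Suc i..<Suc n]). y < \<sigma> i} = \<sigma> ` {b \<in> {Suc i..n}. \<sigma> b < \<sigma> i}" by auto
    moreover have "inj_on \<sigma> {b \<in> {Suc i..n}. \<sigma> b < \<sigma> i}"
      using permutes_inj[OF \<sigma>] by (rule inj_on_subset) simp
    ultimately have "card {y \<in> set (map \<sigma> [Suc i..<Suc n]). y < \<sigma> i} = card {b \<in> {Suc i..n}. \<sigma> b < \<sigma> i}"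
      by (simp only: card_image)
    moreover have "map \<sigma> [i..<Suc n] = \<sigma> i # map \<sigma> [Suc i..<Suc n]" using step.hyps by (simp add: upt_conv_Cons del: upt_Suc)
    moreover have "{i..n} = insert i {Suc i..n}" using step by auto
    ultimately show ?case using step.IH by (simp del: upt_Suc)
  qed
  have "{(i, j). i \<in> {1..n} \<and> j \<in> {1..n} \<and> i < j \<and> \<sigma> i > \<sigma> j} = Sigma {1..n} (\<lambda>a. {b \<in> {Suc a..n}. \<sigma> b < \<sigma> a})"
    by auto
  then show ?thesis using suffix[of 1] by (simp add: perm_inv_def)
qed

lemma run_weight_map_permutes:
  fixes t :: "'a::comm_ring_1"
  assumes \<sigma>: "\<sigma> permutes {1..n}" and n: "n \<ge> 2"
  shows "run_weight t (map \<sigma> [1..<Suc n]) =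
      (if \<sigma> \<in> D_tilde_set n (Suc (perm_des n \<sigma>)) then t ^ Suc (perm_des n \<sigma>) * (1 + t) ^ (n - 2 * Suc (perm_des n \<sigma>)) else 0)"
    and "\<sigma> \<in> D_tilde_set n (Suc (perm_des n \<sigma>)) \<Longrightarrow> 2 * Suc (perm_des n \<sigma>) \<le> n"
proof -
  have neq: "\<sigma> i \<noteq> \<sigma> j" if "i \<noteq> j" for i j
    using permutes_inj[OF \<sigma>] that by (auto dest: injD)
  \<comment> \<open>The suffix starting at position i has d i + 1 runs. \<open>P i\<close> says that
    all of them except perhaps the first have length at least two, and \<open>P' i\<close> that the
    first one has as well.\<close>
  define d where "d = (\<lambda>i. card {k \<in> {i..<n}. \<sigma> k > \<sigma> (k + 1)})"
  define P where "P = (\<lambda>i. (\<forall>k. i < k \<and> k < n \<longrightarrow> \<not> (\<sigma> (k - 1) > \<sigma> k \<and> \<sigma> k > \<sigma> (k + 1))) \<and> (i < n \<longrightarrow> \<sigma> (n - 1) < \<sigma> n))"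
  define P' where "P' = (\<lambda>i. P i \<and> i < n \<and> \<sigma> i < \<sigma> (i + 1))"
  \<comment> \<open>The bounds on \<open>d i\<close> are carried along because the exponents are
    truncated differences: prefixing a smaller letter must raise n - i - 2 d by exactly one.\<close>
  have main: "open_run_weight t (map \<sigma> [i..<Suc n]) = (if P i then t ^ d i * (1 + t) ^ (n - i - 2 * d i) else 0)
      \<and> (P i \<longrightarrow> 2 * d i \<le> n - i)
      \<and> run_weight t (map \<sigma> [i..<Suc n]) = (if P' i then t ^ Suc (d i) * (1 + t) ^ (n + 1 - i - 2 * Suc (d i)) else 0)
      \<and> (P' i \<longrightarrow> 2 * d i + 1 \<le> n - i)" if "i \<le> n" for i
    using that
  proof (induction rule: inc_induct)
    case base
    have "{k \<in> {n..<n}. \<sigma> k > \<sigma> (k + 1)} = {}" by simp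
    then have "d n = 0" by (simp only: d_def card.empty)
    then show ?case by (auto simp: P_def P'_def)
  next
    case (step i)
    have l1: "map \<sigma> [i..<Suc n] = \<sigma> i # map \<sigma> [Suc i..<Suc n]" using step.hyps by (simp add: upt_conv_Cons del: upt_Suc)
    have l2: "map \<sigma> [Suc i..<Suc n] = \<sigma> (Suc i) # map \<sigma> [Suc (Suc i)..<Suc n]"
      using step.hyps by (simp add: upt_conv_Cons del: upt_Suc)
    have ival: "{i..<n} = insert i {Suc i..<n}" using step by auto
    show ?case
    proof (cases "\<sigma> i < \<sigma> (Suc i)")
      case True
      have "{k \<in> {i..<n}. \<sigma> k > \<sigma> (k + 1)} = {k \<in> {Suc i..<n}. \<sigma> k > \<sigma> (k + 1)}"
        unfolding ival using True by auto
      then have dd: "d i = d (Suc i)" by (simp add: d_def)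
      have "k = Suc i \<or> Suc i < k" if "i < k" for k using that by auto
      then have PP: "P i = P (Suc i)" using True step.hyps unfolding P_def
        by (smt (verit, ccfv_SIG) Suc_lessD diff_Suc_1 less_SucE less_Suc_eq not_less_iff_gr_or_eq)
      have PP': "P' i = P (Suc i)" using PP True step.hyps by (simp add: P'_def)
      have W: "run_weight t (map \<sigma> [i..<Suc n]) = t * open_run_weight t (map \<sigma> [Suc i..<Suc n])"
        "open_run_weight t (map \<sigma> [i..<Suc n]) = (1 + t) * open_run_weight t (map \<sigma> [Suc i..<Suc n])"
        unfolding l1 l2 using True by simp_all
      have e: "n - i - 2 * d (Suc i) = Suc (n - Suc i - 2 * d (Suc i))" if "P (Suc i)"
        using step.IH that step.hyps by auto
      have "n + 1 - i - 2 * Suc (d (Suc i)) = n - Suc i - 2 * d (Suc i)" by simp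
      then show ?thesis using step.IH step.hyps e unfolding W dd PP PP' by (auto simp: mult_ac)
    next
      case False
      then have gt: "\<sigma> i > \<sigma> (Suc i)" using neq[of i "Suc i"] by simp
      have "{k \<in> {i..<n}. \<sigma> k > \<sigma> (k + 1)} = insert i {k \<in> {Suc i..<n}. \<sigma> k > \<sigma> (k + 1)}"
        unfolding ival using gt by auto
      then have dd: "d i = Suc (d (Suc i))" by (simp add: d_def)
      have PP: "P i = P' (Suc i)"
      proof
        assume Pi: "P i"
        have "Suc i \<noteq> n"
        proof
          assume "Suc i = n"
          then have "\<sigma> i < \<sigma> (Suc i)" using Pi step.hyps by (auto simp: P_def)
          with gt show False by simp
        qed
        then have lt: "Suc i < n" using step.hyps by simp
        have "\<not> \<sigma> (Suc i) > \<sigma> (Suc (Suc i))" using Pi lt gt by (auto simp: P_def dest!: spec[of _ "Suc i"])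
        then have "\<sigma> (Suc i) < \<sigma> (Suc (Suc i))" using neq[of "Suc i" "Suc (Suc i)"] by simp
        then show "P' (Suc i)" using Pi lt by (auto simp: P'_def P_def)
      next
        assume Pi: "P' (Suc i)"
        show "P i" unfolding P_def
        proof (intro conjI allI impI)
          fix k assume k: "i < k \<and> k < n"
          show "\<not> (\<sigma> (k - 1) > \<sigma> k \<and> \<sigma> k > \<sigma> (k + 1))"
          proof (cases "k = Suc i")
            case True
            then show ?thesis using Pi by (auto simp: P'_def)
          next
            case False
            then show ?thesis using Pi k by (auto simp: P'_def P_def)
          qed
        qed (use Pi in \<open>auto simp: P'_def P_def\<close>)
      qed
      have PP': "\<not> P' i" using gt by (simp add: P'_def)
      have W: "run_weight t (map \<sigma> [i..<Suc n]) = 0"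
        "open_run_weight t (map \<sigma> [i..<Suc n]) = run_weight t (map \<sigma> [Suc i..<Suc n])"
        unfolding l1 l2 using False by simp_all
      show ?thesis using step.IH step.hyps PP' unfolding W dd PP by auto
    qed
  qed
  have d1: "d 1 = perm_des n \<sigma>" by (simp add: d_def perm_des_def)
  \<comment> \<open>As the letters at 0 and n + 1 are infinite, a double descent at 1 is just a
    descent there, and n is never a double descent.\<close>
  have "perm_dd n \<sigma> = 0 \<longleftrightarrow> (\<forall>i\<in>{1..n}. \<not> (perm_letter n \<sigma> (i - 1) > perm_letter n \<sigma> i \<and> perm_letter n \<sigma> i > perm_letter n \<sigma> (i + 1)))"
    by (auto simp: perm_dd_def)
  also have "\<dots> \<longleftrightarrow> \<not> \<sigma> 1 > \<sigma> 2 \<and> (\<forall>k. 1 < k \<and> k < n \<longrightarrow> \<not> (\<sigma> (k - 1) > \<sigma> k \<and> \<sigma> k > \<sigma> (k + 1)))" (is "?A \<longleftrightarrow> ?B")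
  proof
    assume A: ?A
    show ?B
    proof (intro conjI allI impI)
      show "\<not> \<sigma> 1 > \<sigma> 2" using bspec[OF A, of 1] n by (simp add: perm_letter_def numeral_2_eq_2)
    next
      fix k assume "1 < k \<and> k < n"
      then show "\<not> (\<sigma> (k - 1) > \<sigma> k \<and> \<sigma> k > \<sigma> (k + 1))" using bspec[OF A, of k] by (auto simp: perm_letter_def)
    qed
  next
    assume B: ?B
    show ?A
    proof
      fix i assume i: "i \<in> {1..n}"
      consider "i = 1" | "1 < i \<and> i < n" | "i = n" using i by force
      then show "\<not> (perm_letter n \<sigma> (i - 1) > perm_letter n \<sigma> i \<and> perm_letter n \<sigma> i > perm_letter n \<sigma> (i + 1))"
      proof cases
        case 1
        then show ?thesis using B n by (simp add: perm_letter_def numeral_2_eq_2)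
      next
        case 2
        then show ?thesis using B by (auto simp: perm_letter_def)
      next
        case 3
        then show ?thesis by (simp add: perm_letter_def)
      qed
    qed
  qed
  finally have "perm_dd n \<sigma> = 0 \<and> \<sigma> (n - 1) < \<sigma> n \<longleftrightarrow> P' 1"
    using n neq[of 1 2] by (auto simp: P'_def P_def numeral_2_eq_2)
  then have mem: "\<sigma> \<in> D_tilde_set n (Suc (perm_des n \<sigma>)) \<longleftrightarrow> P' 1"
    using \<sigma> by (auto simp: D_tilde_set_def D_set_def)
  have "n + 1 - 1 = n" by simp
  with main[of 1] n show "run_weight t (map \<sigma> [1..<Suc n]) =
      (if \<sigma> \<in> D_tilde_set n (Suc (perm_des n \<sigma>)) then t ^ Suc (perm_des n \<sigma>) * (1 + t) ^ (n - 2 * Suc (perm_des n \<sigma>)) else 0)"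
    unfolding mem d1 by (simp only:)
  show "2 * Suc (perm_des n \<sigma>) \<le> n" if "\<sigma> \<in> D_tilde_set n (Suc (perm_des n \<sigma>))"
    using main[of 1] n that unfolding mem d1 by auto
qed

lemma run_sum_eq_D_tilde:
  fixes t q :: "'a::comm_ring_1"
  assumes "n \<ge> 1"
  shows "run_sum t q {1..n} =
    (\<Sum>k = 1..n div 2. (\<Sum>\<sigma> \<in> D_tilde_set n k. q ^ perm_inv n \<sigma>) * t ^ k * (1 + t) ^ (n - 2 * k))"
\<comment> \<open>For n = 1 both sides vanish: a run of one letter has weight 0, and the range of k
  is empty.\<close>
proof (cases "n = 1")
  case True
  then show ?thesis by (simp add: run_sum_def)
next
  case False
  with assms have n: "n \<ge> 2" by simp
  let ?S = "{\<sigma>. \<sigma> permutes {1..n}}"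
  have fin: "finite ?S" by (simp add: finite_permutations)
  have "run_sum t q {1..n} = (\<Sum>\<sigma>\<in>?S. q ^ list_inv (map \<sigma> [1..<Suc n]) * run_weight t (map \<sigma> [1..<Suc n]))"
    unfolding run_sum_def by (rule sum.reindex_bij_betw[OF bij_betw_permutes_permutations_of_set, symmetric])
  also have "\<dots> = (\<Sum>\<sigma>\<in>?S. \<Sum>k=1..n div 2. if \<sigma> \<in> D_tilde_set n k then q ^ perm_inv n \<sigma> * t ^ k * (1 + t) ^ (n - 2 * k) else 0)"
  proof (rule sum.cong[OF refl])
    fix \<sigma> assume "\<sigma> \<in> ?S"
    then have \<sigma>: "\<sigma> permutes {1..n}" by simp
    let ?d = "Suc (perm_des n \<sigma>)"
    have only: "k = ?d" if "\<sigma> \<in> D_tilde_set n k" "k \<in> {1..n div 2}" for k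
      using that by (auto simp: D_tilde_set_def D_set_def)
    have "(\<Sum>k=1..n div 2. if \<sigma> \<in> D_tilde_set n k then q ^ perm_inv n \<sigma> * t ^ k * (1 + t) ^ (n - 2 * k) else 0)
      = (\<Sum>k=1..n div 2. if k = ?d then (if \<sigma> \<in> D_tilde_set n ?d then q ^ perm_inv n \<sigma> * t ^ ?d * (1 + t) ^ (n - 2 * ?d) else 0) else 0)"
    proof (rule sum.cong[OF refl])
      fix k assume k: "k \<in> {1..n div 2}"
      show "(if \<sigma> \<in> D_tilde_set n k then q ^ perm_inv n \<sigma> * t ^ k * (1 + t) ^ (n - 2 * k) else 0) =
        (if k = ?d then (if \<sigma> \<in> D_tilde_set n ?d then q ^ perm_inv n \<sigma> * t ^ ?d * (1 + t) ^ (n - 2 * ?d) else 0) else 0)"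
      proof (cases "k = ?d")
        case False
        then have "\<sigma> \<notin> D_tilde_set n k" using only[OF _ k] by blast
        with False show ?thesis by simp
      qed simp
    qed
    also have "\<dots> = (if \<sigma> \<in> D_tilde_set n ?d then q ^ perm_inv n \<sigma> * t ^ ?d * (1 + t) ^ (n - 2 * ?d) else 0)"
      using run_weight_map_permutes(2)[OF \<sigma> n] by (auto simp: sum.delta)
    finally show "q ^ list_inv (map \<sigma> [1..<Suc n]) * run_weight t (map \<sigma> [1..<Suc n]) =
       (\<Sum>k=1..n div 2. if \<sigma> \<in> D_tilde_set n k then q ^ perm_inv n \<sigma> * t ^ k * (1 + t) ^ (n - 2 * k) else 0)"
      unfolding list_inv_map_permutes[OF \<sigma>] run_weight_map_permutes(1)[OF \<sigma> n] by (simp add: mult_ac)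
  qed
  also have "\<dots> = (\<Sum>k=1..n div 2. \<Sum>\<sigma>\<in>?S. if \<sigma> \<in> D_tilde_set n k then q ^ perm_inv n \<sigma> * t ^ k * (1 + t) ^ (n - 2 * k) else 0)"
    by (rule sum.swap)
  also have "\<dots> = (\<Sum>k = 1..n div 2. (\<Sum>\<sigma> \<in> D_tilde_set n k. q ^ perm_inv n \<sigma>) * t ^ k * (1 + t) ^ (n - 2 * k))"
  proof (rule sum.cong[OF refl])
    fix k
    have D: "D_tilde_set n k = {\<sigma> \<in> ?S. \<sigma> \<in> D_tilde_set n k}" by (auto simp: D_tilde_set_def D_set_def)
    have "(\<Sum>\<sigma> \<in> D_tilde_set n k. q ^ perm_inv n \<sigma> * t ^ k * (1 + t) ^ (n - 2 * k)) =
      (\<Sum>\<sigma>\<in>?S. if \<sigma> \<in> D_tilde_set n k then q ^ perm_inv n \<sigma> * t ^ k * (1 + t) ^ (n - 2 * k) else 0)"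
      by (subst D) (rule sum.inter_filter[OF fin])
    then show "(\<Sum>\<sigma>\<in>?S. if \<sigma> \<in> D_tilde_set n k then q ^ perm_inv n \<sigma> * t ^ k * (1 + t) ^ (n - 2 * k) else 0)
      = (\<Sum>\<sigma> \<in> D_tilde_set n k. q ^ perm_inv n \<sigma>) * t ^ k * (1 + t) ^ (n - 2 * k)"
      by (simp add: sum_distrib_right)
  qed
  finally show ?thesis .
qed

section \<open>Derangements and strict chains\<close>

text \<open>
  The descent set of the word in which every excedance value is made smaller than every other
  value. Turning from excedance to non-excedance at \<open>i\<close> is always a descent, and the other way round
  never is, so the two descent sets differ exactly at these turns, which telescope to \<open>exc\<close>.
\<close>

definition dex_set :: "nat \<Rightarrow> (nat \<Rightarrow> nat) \<Rightarrow> nat set" where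
  "dex_set n \<sigma> = {i \<in> {1..<n}. (\<sigma> i < i \<and> \<sigma> (Suc i) > Suc i) \<or>
     ((\<sigma> i > i \<longleftrightarrow> \<sigma> (Suc i) > Suc i) \<and> \<sigma> i > \<sigma> (Suc i))}"

lemma sum_dex_set:
  assumes \<sigma>: "\<sigma> permutes {1..n}" and nofix: "\<And>i. i \<in> {1..n} \<Longrightarrow> \<sigma> i \<noteq> i"
  shows "\<Sum>(dex_set n \<sigma>) = perm_maj n \<sigma> - perm_exc n \<sigma>"
proof (cases "n = 0")
  case True
  then show ?thesis by (simp add: dex_set_def perm_maj_def perm_exc_def)
next
  case False
  define u where "u = (\<lambda>i. if \<sigma> i > i then 1 else 0 :: int)"
  \<comment> \<open>With u the indicator of excedances, membership in the descent set exceeds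
    membership in \<open>dex_set\<close> by u i - u (i + 1). Weighted by i this is summed by parts;
    the boundary term vanishes because n is not an excedance.\<close>
  have abel: "(\<Sum>i\<in>{1..<Suc m}. int i * (u i - u (Suc i))) = (\<Sum>i=1..m. u i) - int m * u (Suc m)" for m
    by (induction m) (simp_all add: algebra_simps)
  have "\<sigma> n \<in> {1..n}" using permutes_in_image[OF \<sigma>, of n] False by simp
  then have un: "u n = 0" by (simp add: u_def)
  obtain m where m: "n = Suc m" using False by (cases n) auto
  have "(\<Sum>i=1..n. u i) = int (perm_exc n \<sigma>)"
    unfolding u_def perm_exc_def by (simp add: sum.If_cases Int_def)
  then have exc: "(\<Sum>i\<in>{1..<n}. int i * (u i - u (Suc i))) = int (perm_exc n \<sigma>)"
    using abel[of m] un m by simp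
  have "int (perm_maj n \<sigma>) = (\<Sum>i\<in>{1..<n}. if \<sigma> i > \<sigma> (i + 1) then int i else 0)"
    unfolding perm_maj_def by (simp add: sum.inter_filter[symmetric])
  also have "\<dots> = (\<Sum>i\<in>{1..<n}. (if i \<in> dex_set n \<sigma> then int i else 0) + int i * (u i - u (Suc i)))"
  proof (rule sum.cong[OF refl])
    fix i assume i: "i \<in> {1..<n}"
    then have "\<sigma> i \<noteq> i" "\<sigma> (Suc i) \<noteq> Suc i" using nofix by auto
    then show "(if \<sigma> i > \<sigma> (i + 1) then int i else 0) = (if i \<in> dex_set n \<sigma> then int i else 0) + int i * (u i - u (Suc i))"
      using i by (auto simp: dex_set_def u_def)
  qed
  also have "\<dots> = int (\<Sum>(dex_set n \<sigma>)) + int (perm_exc n \<sigma>)"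
  proof -
    have D: "dex_set n \<sigma> = {i \<in> {1..<n}. i \<in> dex_set n \<sigma>}" by (auto simp: dex_set_def)
    have "(\<Sum>i\<in>dex_set n \<sigma>. int i) = (\<Sum>i\<in>{1..<n}. if i \<in> dex_set n \<sigma> then int i else 0)"
      by (subst D) (rule sum.inter_filter, simp)
    then show ?thesis by (simp only: sum.distrib exc of_nat_sum)
  qed
  finally show ?thesis by linarith
qed

section \<open>Chains with prescribed strict steps and their limiting generating function\<close>

definition chain_funs :: "nat \<Rightarrow> nat \<Rightarrow> nat set \<Rightarrow> (nat \<Rightarrow> nat) set" where
  "chain_funs n N D = {g \<in> {1..n} \<rightarrow>\<^sub>E {..<N}. \<forall>i\<in>{1..<n}. g i \<le> g (Suc i) \<and> (i \<in> D \<longrightarrow> g i < g (Suc i))}"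

lemma finite_chain_funs [simp]: "finite (chain_funs n N D)"
  by (rule finite_subset[of _ "{1..n} \<rightarrow>\<^sub>E {..<N}"]) (auto simp: chain_funs_def intro: finite_PiE)

lemma chain_funs_mono:
  assumes "g \<in> chain_funs n N D" "i \<le> j" "1 \<le> i" "j \<le> n"
  shows "g i \<le> g j"
  using assms(2,4)
proof (induction rule: dec_induct)
  case (step k)
  then have "g k \<le> g (Suc k)" using assms by (auto simp: chain_funs_def)
  then show ?case using step by simp
qed simp

lemma chain_funs_Suc_Suc:
  assumes "0 \<notin> D"
  shows "chain_funs (Suc n) (Suc N) D = chain_funs (Suc n) N D \<union>
    (\<lambda>g. g(Suc n := N)) ` chain_funs n (if n \<in> D then N else Suc N) D" (is "?L = ?A \<union> ?f ` ?B")
proof (intro equalityI subsetI)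
  fix g assume g: "g \<in> ?L"
  have dom: "g i < Suc N" if "i \<in> {1..Suc n}" for i using g that by (auto simp: chain_funs_def)
  show "g \<in> ?A \<union> ?f ` ?B"
  proof (cases "g (Suc n) = N")
    case False
    then have "g (Suc n) < N" using dom[of "Suc n"] by auto
    then have "g i < N" if "i \<in> {1..Suc n}" for i
      using chain_funs_mono[OF g, of i "Suc n"] that by auto
    then have "g \<in> ?A" using g by (auto simp: chain_funs_def PiE_def)
    then show ?thesis by simp
  next
    case True
    define h where "h = g(Suc n := undefined)"
    have ne: "n \<noteq> 0" if "n \<in> D" using assms that by (cases n) auto
    have "g i < (if n \<in> D then N else Suc N)" if "i \<in> {1..n}" for i
    proof (cases "n \<in> D")
      case nD: True
      then have "g n < g (Suc n)" using g ne[OF nD] by (auto simp: chain_funs_def)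
      moreover have "g i \<le> g n" using chain_funs_mono[OF g, of i n] that by auto
      ultimately show ?thesis using True nD by simp
    next
      case False
      then show ?thesis using dom that by simp
    qed
    then have "h \<in> ?B" using g by (auto simp: chain_funs_def h_def PiE_def extensional_def)
    moreover have "g = ?f h" using True by (auto simp: h_def)
    ultimately show ?thesis by blast
  qed
next
  fix g assume "g \<in> ?A \<union> ?f ` ?B"
  then show "g \<in> ?L"
  proof
    assume "g \<in> ?A"
    then show ?thesis by (auto simp: chain_funs_def PiE_def Pi_def less_Suc_eq)
  next
    assume "g \<in> ?f ` ?B"
    then obtain h where h: "h \<in> ?B" "g = h(Suc n := N)" by auto
    have hN: "h i < (if n \<in> D then N else Suc N)" if "i \<in> {1..n}" for i
      using h that by (auto simp: chain_funs_def)
    have hN': "h i < Suc N" if "i \<in> {1..n}" for i using hN[OF that] by (simp split: if_splits)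
    have "g i < Suc N" if "i \<in> {1..Suc n}" for i
      using hN'[of i] h(2) that by (cases "i = Suc n") auto
    moreover have "g i = undefined" if "i \<notin> {1..Suc n}" for i
      using h that by (auto simp: chain_funs_def PiE_def extensional_def)
    ultimately have "g \<in> {1..Suc n} \<rightarrow>\<^sub>E {..<Suc N}" by (intro PiE_I) auto
    moreover have "g i \<le> g (Suc i) \<and> (i \<in> D \<longrightarrow> g i < g (Suc i))" if i: "i \<in> {1..<Suc n}" for i
    proof (cases "i = n")
      case True
      then show ?thesis using h(2) hN[of n] i by (auto split: if_splits)
    next
      case False
      then show ?thesis using h i by (auto simp: chain_funs_def)
    qed
    ultimately show ?thesis by (auto simp: chain_funs_def)
  qed
qed

definition chain_sum :: "(nat \<Rightarrow> 'a::comm_ring_1) \<Rightarrow> nat \<Rightarrow> nat \<Rightarrow> nat set \<Rightarrow> 'a" where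
  "chain_sum x n N D = (\<Sum>g\<in>chain_funs n N D. \<Prod>i=1..n. x (g i))"

text \<open>Split according to whether the last value is the top value N. If it is not, allowing one
  more value raises each of the n + 1 reversed exponents by one, whence q^(n + 1). If it is, the
  last factor is 1 and the first n values form a shorter chain, which must avoid N when the step at
  n is strict.\<close>

lemma chain_sum_Suc_Suc:
  fixes q :: "'a::comm_ring_1"
  defines "H \<equiv> \<lambda>n N. chain_sum (\<lambda>b. q ^ (N - Suc b)) n N"
  assumes "0 \<notin> D"
  shows "H (Suc n) (Suc N) D = q ^ Suc n * H (Suc n) N D + (if n \<in> D then q ^ n * H n N D else H n (Suc N) D)"
proof -
  let ?M = "if n \<in> D then N else Suc N"
  let ?f = "\<lambda>g. g(Suc n := N)"
  have inj: "inj_on ?f (chain_funs n ?M D)"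
  proof (rule inj_onI)
    fix g h assume a: "g \<in> chain_funs n ?M D" "h \<in> chain_funs n ?M D" "?f g = ?f h"
    have "g (Suc n) = h (Suc n)" using a by (auto simp: chain_funs_def PiE_def extensional_def)
    then show "g = h" using a(3) by (metis fun_upd_triv fun_upd_upd)
  qed
  have disj: "chain_funs (Suc n) N D \<inter> ?f ` chain_funs n ?M D = {}"
    by (auto simp: chain_funs_def PiE_def Pi_def)
  have shift: "(\<Prod>i=1..m. q ^ (Suc N - Suc (g i))) = q ^ m * (\<Prod>i=1..m. q ^ (N - Suc (g i)))" if "g \<in> chain_funs m N D" for m g
  proof -
    have "(\<Prod>i=1..m. q ^ (Suc N - Suc (g i))) = (\<Prod>i=1..m. q * q ^ (N - Suc (g i)))"
    proof (rule prod.cong[OF refl])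
      fix i assume "i \<in> {1..m}"
      then have "g i < N" using that by (auto simp: chain_funs_def)
      then have "Suc N - Suc (g i) = Suc (N - Suc (g i))" by simp
      then show "q ^ (Suc N - Suc (g i)) = q * q ^ (N - Suc (g i))" by (simp only: power_Suc)
    qed
    then show ?thesis by (simp add: prod.distrib)
  qed
  have "H (Suc n) (Suc N) D = (\<Sum>g\<in>chain_funs (Suc n) N D. \<Prod>i=1..Suc n. q ^ (Suc N - Suc (g i)))
     + (\<Sum>g\<in>chain_funs n ?M D. \<Prod>i=1..Suc n. q ^ (Suc N - Suc (?f g i)))"
    unfolding H_def chain_sum_def chain_funs_Suc_Suc[OF assms(2)]
    by (subst sum.union_disjoint) (use disj in \<open>auto simp: sum.reindex[OF inj]\<close>)
  also have "(\<Sum>g\<in>chain_funs (Suc n) N D. \<Prod>i=1..Suc n. q ^ (Suc N - Suc (g i))) = q ^ Suc n * H (Suc n) N D"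
    unfolding H_def chain_sum_def sum_distrib_left by (intro sum.cong refl shift)
  also have "(\<Sum>g\<in>chain_funs n ?M D. \<Prod>i=1..Suc n. q ^ (Suc N - Suc (?f g i))) = (\<Sum>g\<in>chain_funs n ?M D. \<Prod>i=1..n. q ^ (Suc N - Suc (g i)))"
  proof (rule sum.cong[OF refl])
    fix g
    have "(\<Prod>i=1..n. q ^ (Suc N - Suc (?f g i))) = (\<Prod>i=1..n. q ^ (Suc N - Suc (g i)))"
      by (intro prod.cong) auto
    then show "(\<Prod>i=1..Suc n. q ^ (Suc N - Suc (?f g i))) = (\<Prod>i=1..n. q ^ (Suc N - Suc (g i)))" by simp
  qed
  also have "\<dots> = (if n \<in> D then q ^ n * H n N D else H n (Suc N) D)"
  proof (cases "n \<in> D")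
    case True
    show ?thesis unfolding H_def chain_sum_def sum_distrib_left
      by (simp only: True if_True) (intro sum.cong refl shift)
  next
    case False
    then show ?thesis unfolding H_def chain_sum_def by (simp only: if_False)
  qed
  finally show ?thesis .
qed

lemma affine_recurrence_tendsto:
  fixes a b :: "nat \<Rightarrow> real"
  assumes r: "0 \<le> r" "r < 1" and rec: "\<And>N. a (Suc N) = r * a N + b N" and b: "b \<longlonglongrightarrow> B"
  shows "a \<longlonglongrightarrow> B / (1 - r)"
proof -
  define L where "L = B / (1 - r)"
  have L: "L = r * L + B" using r by (simp add: L_def field_simps)
  define e where "e = (\<lambda>N. a N - L)"
  have e: "e (Suc N) = r * e N + (b N - B)" for N
    unfolding e_def rec using L by (simp add: algebra_simps)
  have "e \<longlonglongrightarrow> 0"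
  proof (rule LIMSEQ_I)
    fix \<epsilon> :: real assume \<epsilon>: "0 < \<epsilon>"
    \<comment> \<open>Chosen such that r * (\<epsilon> / 2) + \<delta> = \<epsilon> / 2, so the
      bound below reproduces itself.\<close>
    define \<delta> where "\<delta> = \<epsilon> * (1 - r) / 2"
    have \<delta>: "\<delta> > 0" using \<epsilon> r by (simp add: \<delta>_def)
    obtain M where M: "\<bar>b N - B\<bar> < \<delta>" if "N \<ge> M" for N
      using LIMSEQ_D[OF b \<delta>] by auto
    have bound: "\<bar>e (M + k)\<bar> \<le> r ^ k * \<bar>e M\<bar> + \<epsilon> / 2" for k
    proof (induction k)
      case 0
      then show ?case using \<epsilon> by simp
    next
      case (Suc k)
      have "\<bar>e (M + Suc k)\<bar> \<le> \<bar>r * e (M + k)\<bar> + \<bar>b (M + k) - B\<bar>" using e[of "M + k"] by simp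
      also have "\<dots> \<le> r * \<bar>e (M + k)\<bar> + \<delta>" using M[of "M + k"] r by (simp add: abs_mult)
      also have "\<dots> \<le> r * (r ^ k * \<bar>e M\<bar> + \<epsilon> / 2) + \<delta>" using Suc r by (simp add: mult_left_mono)
      also have "\<dots> = r ^ Suc k * \<bar>e M\<bar> + \<epsilon> / 2" by (simp add: \<delta>_def field_simps)
      finally show ?case .
    qed
    have "(\<lambda>k. r ^ k * \<bar>e M\<bar>) \<longlonglongrightarrow> 0 * \<bar>e M\<bar>"
      using r by (intro tendsto_mult LIMSEQ_realpow_zero tendsto_const) auto
    then obtain K where K: "r ^ k * \<bar>e M\<bar> < \<epsilon> / 2" if "k \<ge> K" for k
      using LIMSEQ_D[of "\<lambda>k. r ^ k * \<bar>e M\<bar>" 0 "\<epsilon> / 2"] \<epsilon> r by (auto simp: abs_mult)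
    have "norm (e N - 0) < \<epsilon>" if "N \<ge> M + K" for N
    proof -
      have "N - M \<ge> K" "M + (N - M) = N" using that by auto
      with bound[of "N - M"] K[of "N - M"] show ?thesis by simp
    qed
    then show "\<exists>no. \<forall>n\<ge>no. norm (e n - 0) < \<epsilon>" by blast
  qed
  then show ?thesis using LIM_zero_cancel unfolding e_def L_def by blast
qed

lemma q_fact_pos: "0 < q \<Longrightarrow> q < 1 \<Longrightarrow> q_fact (q::real) n > 0"
  unfolding q_fact_def by (intro prod_pos) (auto simp: power_less_one_iff)

text \<open>The recurrence in N has the fixed point obtained by dividing by 1 - q^(n + 1). So every
  position i contributes 1 / (1 - q^i), and every strict step i an extra q^i: the generating
  function of P-partitions of a chain.\<close>

lemma chain_sum_tendsto:
  fixes q :: real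
  assumes q: "0 < q" "q < 1" and D: "0 \<notin> D" "finite D"
  shows "(\<lambda>N. chain_sum (\<lambda>b. q ^ (N - Suc b)) n N D) \<longlonglongrightarrow> q ^ \<Sum>{i \<in> D. i < n} / q_fact q n"
proof (induction n)
  case 0
  have "chain_funs 0 N D = {\<lambda>_. undefined}" for N by (auto simp: chain_funs_def)
  then show ?case by (simp add: chain_sum_def)
next
  case (Suc n)
  let ?H = "\<lambda>n N. chain_sum (\<lambda>b. q ^ (N - Suc b)) n N D"
  let ?b = "\<lambda>N. if n \<in> D then q ^ n * ?H n N else ?H n (Suc N)"
  have sum: "\<Sum>{i \<in> D. i < Suc n} = (if n \<in> D then n else 0) + \<Sum>{i \<in> D. i < n}"
  proof (cases "n \<in> D")
    case True
    then have "{i \<in> D. i < Suc n} = insert n {i \<in> D. i < n}" by auto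
    then show ?thesis using True D by simp
  next
    case False
    then have "{i \<in> D. i < Suc n} = {i \<in> D. i < n}" by (auto simp: less_Suc_eq)
    then show ?thesis using False by simp
  qed
  have "?b \<longlonglongrightarrow> q ^ (if n \<in> D then n else 0) * (q ^ \<Sum>{i \<in> D. i < n} / q_fact q n)"
    using tendsto_mult_left[OF Suc, of "q ^ n"] LIMSEQ_Suc[OF Suc] by auto
  then have b: "?b \<longlonglongrightarrow> q ^ \<Sum>{i \<in> D. i < Suc n} / q_fact q n" by (simp add: sum power_add)
  have "(\<lambda>N. ?H (Suc n) N) \<longlonglongrightarrow> (q ^ \<Sum>{i \<in> D. i < Suc n} / q_fact q n) / (1 - q ^ Suc n)"
    by (rule affine_recurrence_tendsto[OF _ _ chain_sum_Suc_Suc[OF D(1)] b]) (use q in \<open>auto simp: power_less_one_iff simp del: power_Suc\<close>)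
  then show ?case by (simp only: q_fact_Suc divide_divide_eq_left)
qed

section \<open>Derangements as words\<close>

definition derangements :: "nat \<Rightarrow> (nat \<Rightarrow> nat) set" where
  "derangements n = {\<sigma>. \<sigma> permutes {1..n} \<and> (\<forall>i\<in>{1..n}. \<sigma> i \<noteq> i)}"

lemma finite_derangements [simp]: "finite (derangements n)"
  by (rule finite_subset[OF _ finite_permutations[of "{1..n}"]]) (auto simp: derangements_def)

definition word_less :: "nat \<Rightarrow> (nat \<Rightarrow> nat) \<Rightarrow> nat \<Rightarrow> nat" where
  "word_less n w r = card {i \<in> {1..n}. w i < r}"

text \<open>The standardization of the word: equal letters are ranked from left to right. Its
  inverse lists the positions sorted by (letter, position), and this is how the derangement is
  recovered.\<close>

definition word_rank :: "nat \<Rightarrow> (nat \<Rightarrow> nat) \<Rightarrow> nat \<Rightarrow> nat" where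
  "word_rank n w j = card {i \<in> {1..n}. w i < w j \<or> w i = w j \<and> i \<le> j}"

text \<open>
  The letter \<open>2 b\<close> marks the image of an excedance with chain value \<open>b\<close>, the letter \<open>2 b + 1\<close> that of an
  anti-excedance. As the derangement increases on the positions carrying a fixed letter, it suffices to
  ask for \<open>\<sigma> i > i\<close> at the first and for \<open>\<sigma> i < i\<close> at the last of them.
\<close>

definition exc_words :: "nat \<Rightarrow> nat \<Rightarrow> (nat \<Rightarrow> nat) set" where
  "exc_words n N = {w \<in> {1..n} \<rightarrow>\<^sub>E {..<2 * N}. \<forall>j\<in>{1..n}.
     (even (w j) \<longrightarrow> word_less n w (w j) + 2 \<le> j) \<and> (odd (w j) \<longrightarrow> j < word_less n w (Suc (w j)))}"

lemma exc_words_iff_rank: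
  assumes w: "w \<in> {1..n} \<rightarrow>\<^sub>E {..<2 * N}"
  shows "w \<in> exc_words n N \<longleftrightarrow>
    (\<forall>j\<in>{1..n}. (even (w j) \<longrightarrow> word_rank n w j < j) \<and> (odd (w j) \<longrightarrow> j < word_rank n w j))"
proof -
  have rank: "word_rank n w j = word_less n w (w j) + card {i \<in> {1..n}. w i = w j \<and> i \<le> j}" for j
  proof -
    have eq: "{i \<in> {1..n}. w i < w j \<or> w i = w j \<and> i \<le> j} =
      {i \<in> {1..n}. w i < w j} \<union> {i \<in> {1..n}. w i = w j \<and> i \<le> j}" by auto
    have "card {i \<in> {1..n}. w i < w j \<or> w i = w j \<and> i \<le> j} = card {i \<in> {1..n}. w i < w j} + card {i \<in> {1..n}. w i = w j \<and> i \<le> j}"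
      unfolding eq by (rule card_Un_disjoint) auto
    then show ?thesis by (simp only: word_rank_def word_less_def)
  qed
  have rank': "word_less n w (Suc (w j)) = word_rank n w j + card {i \<in> {1..n}. w i = w j \<and> j < i}" for j
  proof -
    have eq: "{i \<in> {1..n}. w i < Suc (w j)} =
      {i \<in> {1..n}. w i < w j \<or> w i = w j \<and> i \<le> j} \<union> {i \<in> {1..n}. w i = w j \<and> j < i}" by auto
    have "card {i \<in> {1..n}. w i < Suc (w j)} = card {i \<in> {1..n}. w i < w j \<or> w i = w j \<and> i \<le> j} + card {i \<in> {1..n}. w i = w j \<and> j < i}"
      unfolding eq by (rule card_Un_disjoint) auto
    then show ?thesis by (simp only: word_rank_def word_less_def)
  qed
  show ?thesis
  proof
    assume "w \<in> exc_words n N"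
    then have ev: "\<And>j. j \<in> {1..n} \<Longrightarrow> even (w j) \<Longrightarrow> word_less n w (w j) + 2 \<le> j"
      and od: "\<And>j. j \<in> {1..n} \<Longrightarrow> odd (w j) \<Longrightarrow> j < word_less n w (Suc (w j))" by (auto simp: exc_words_def)
    show "\<forall>j\<in>{1..n}. (even (w j) \<longrightarrow> word_rank n w j < j) \<and> (odd (w j) \<longrightarrow> j < word_rank n w j)"
    proof (intro ballI conjI impI)
      fix j assume j: "j \<in> {1..n}" and e: "even (w j)"
      \<comment> \<open>The occurrences up to j are distinct positions between the bound and j, so
        there are at most j - 1 - \<open>word_less n w (w j)\<close> of them.\<close>
      have "{i \<in> {1..n}. w i = w j \<and> i \<le> j} \<subseteq> {word_less n w (w j) + 2..j}"
        using ev e by fastforce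
      then have "card {i \<in> {1..n}. w i = w j \<and> i \<le> j} \<le> card {word_less n w (w j) + 2..j}"
        by (intro card_mono) auto
      then show "word_rank n w j < j" using rank[of j] ev[OF j e] by simp
    next
      fix j assume j: "j \<in> {1..n}" and e: "odd (w j)"
      have "{i \<in> {1..n}. w i = w j \<and> j < i} \<subseteq> {j<..<word_less n w (Suc (w j))}"
        using od e by fastforce
      then have "card {i \<in> {1..n}. w i = w j \<and> j < i} \<le> card {j<..<word_less n w (Suc (w j))}"
        by (intro card_mono) auto
      then show "j < word_rank n w j" using rank'[of j] od[OF j e] by simp
    qed
  next
    assume R: "\<forall>j\<in>{1..n}. (even (w j) \<longrightarrow> word_rank n w j < j) \<and> (odd (w j) \<longrightarrow> j < word_rank n w j)"
    show "w \<in> exc_words n N"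
      unfolding exc_words_def
    proof (intro CollectI conjI w ballI impI)
      fix j assume j: "j \<in> {1..n}" and e: "even (w j)"
      let ?S = "{i \<in> {1..n}. w i = w j}"
      have fS: "finite ?S" "?S \<noteq> {}" using j by auto
      \<comment> \<open>The first occurrence has rank \<open>word_less\<close> + 1, and this rank
        must be smaller than its position; hence the 2 in the definition of
        \<open>exc_words\<close>.\<close>
      define m where "m = Min ?S"
      have m: "m \<in> {1..n}" "w m = w j" "m \<le> j" using Min_in[OF fS] Min_le[OF fS(1), of j] j m_def by auto
      have "{i \<in> {1..n}. w i = w m \<and> i \<le> m} = {m}"
      proof (intro equalityI subsetI)
        fix i assume i: "i \<in> {i \<in> {1..n}. w i = w m \<and> i \<le> m}"
        then have "i \<in> ?S" using m(2) by simp
        then have "m \<le> i" unfolding m_def by (rule Min_le[OF fS(1)])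
        then show "i \<in> {m}" using i by simp
      qed (use m(1) in simp)
      then have "word_rank n w m = word_less n w (w j) + 1" using rank[of m] m by simp
      moreover have "word_rank n w m < m" using R m e by auto
      ultimately show "word_less n w (w j) + 2 \<le> j" using m by simp
    next
      fix j assume j: "j \<in> {1..n}" and e: "odd (w j)"
      then show "j < word_less n w (Suc (w j))" using R rank'[of j] by fastforce
    qed
  qed
qed

lemma word_rank_mono_iff:
  assumes "i \<in> {1..n}" "j \<in> {1..n}"
  shows "word_rank n w i \<le> word_rank n w j \<longleftrightarrow> w i < w j \<or> w i = w j \<and> i \<le> j"
proof -
  have imp: "word_rank n w i \<le> word_rank n w j" if "w i < w j \<or> w i = w j \<and> i \<le> j" for i j
    unfolding word_rank_def using that by (intro card_mono) auto
  have "word_rank n w j < word_rank n w i" if "\<not> (w i < w j \<or> w i = w j \<and> i \<le> j)"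
    unfolding word_rank_def using that assms by (intro psubset_card_mono) auto
  then show ?thesis using imp[of i j] by fastforce
qed

lemma word_rank_permutes:
  "(\<lambda>j. if j \<in> {1..n} then word_rank n w j else j) permutes {1..n}"
proof (rule bij_imp_permutes)
  let ?f = "\<lambda>j. if j \<in> {1..n} then word_rank n w j else j"
  have inj: "inj_on ?f {1..n}"
  proof (rule inj_onI)
    fix i j assume a: "i \<in> {1..n}" "j \<in> {1..n}" "?f i = ?f j"
    then show "i = j" using word_rank_mono_iff[of i n j w] word_rank_mono_iff[of j n i w] by auto
  qed
  have "?f ` {1..n} \<subseteq> {1..n}"
  proof
    fix y assume "y \<in> ?f ` {1..n}"
    then obtain j where j: "j \<in> {1..n}" "y = word_rank n w j" by auto
    have "word_rank n w j \<le> card {1..n}" unfolding word_rank_def by (intro card_mono) auto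
    moreover have "word_rank n w j \<noteq> 0" unfolding word_rank_def using j by auto
    ultimately show "y \<in> {1..n}" using j(2) by simp
  qed
  then have "?f ` {1..n} = {1..n}" using inj by (intro endo_inj_surj) auto
  with inj show "bij_betw ?f {1..n} {1..n}" by (rule bij_betw_imageI)
qed auto

definition exc_letter_weight :: "'a::comm_ring_1 \<Rightarrow> (nat \<Rightarrow> 'a) \<Rightarrow> nat \<Rightarrow> 'a" where
  "exc_letter_weight t x r = (if even r then t * x (r div 2) else x (r div 2))"

text \<open>The letter at place \<open>\<sigma> i\<close> records \<open>g i\<close> and the type of
  i. Sorting places by (letter, place) returns \<open>\<sigma> 1\<close>, \<open>\<sigma> 2\<close>,
  ... iff \<open>g\<close> increases weakly, and strictly wherever a tie would put an odd letter
  before an even one, or a larger place before a smaller one with the same letter. These are the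
  elements of \<open>dex_set\<close>, which explains its form.\<close>

lemma sum_chain_funs_eq_words:
  fixes t :: "'a::comm_ring_1"
  shows "(\<Sum>\<sigma>\<in>derangements n. t ^ perm_exc n \<sigma> * chain_sum x n N (dex_set n \<sigma>)) =
    (\<Sum>w\<in>exc_words n N. \<Prod>j=1..n. exc_letter_weight t x (w j))"
proof -
  let ?X = "Sigma (derangements n) (\<lambda>\<sigma>. chain_funs n N (dex_set n \<sigma>))"
  define dn where "dn = (\<lambda>i j::nat. if j < i then 1 else 0::nat)"
  define wd where "wd = (\<lambda>(\<sigma>, g). \<lambda>j\<in>{1..n}. 2 * g (inv \<sigma> j) + dn (inv \<sigma> j) j)"
  define rk where "rk = (\<lambda>w j. if j \<in> {1..n} then word_rank n w j else j)"
  define un where "un = (\<lambda>w. (inv (rk w), \<lambda>i\<in>{1..n}. w (inv (rk w) i) div 2))"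
  have rk_perm: "rk w permutes {1..n}" for w unfolding rk_def by (rule word_rank_permutes)
  have "(\<Sum>\<sigma>\<in>derangements n. t ^ perm_exc n \<sigma> * chain_sum x n N (dex_set n \<sigma>)) =
    (\<Sum>(\<sigma>, g)\<in>?X. t ^ perm_exc n \<sigma> * (\<Prod>i=1..n. x (g i)))"
    unfolding chain_sum_def sum_distrib_left by (subst sum.Sigma) auto
  also have "\<dots> = (\<Sum>w\<in>exc_words n N. \<Prod>j=1..n. exc_letter_weight t x (w j))"
  proof (rule sum.reindex_bij_witness[where j = wd and i = un])
    fix p assume "p \<in> ?X"
    then obtain \<sigma> g where p: "p = (\<sigma>, g)" "\<sigma> permutes {1..n}" "\<And>i. i \<in> {1..n} \<Longrightarrow> \<sigma> i \<noteq> i" "g \<in> chain_funs n N (dex_set n \<sigma>)"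
      by (auto simp: derangements_def)
    define w where "w = wd p"
    have \<sigma>in: "\<sigma> i \<in> {1..n} \<longleftrightarrow> i \<in> {1..n}" for i using permutes_in_image[OF p(2)] .
    have w\<sigma>: "w (\<sigma> i) = 2 * g i + dn i (\<sigma> i)" if "i \<in> {1..n}" for i
      using \<sigma>in[of i] that p(2) by (simp add: w_def wd_def p(1) permutes_inverses)
    have gN: "g i < N" if "i \<in> {1..n}" for i using p(4) that by (auto simp: chain_funs_def)
    have \<sigma>ex: "\<exists>i\<in>{1..n}. j = \<sigma> i" if "j \<in> {1..n}" for j
      using permutes_image[OF p(2)] that by blast
    have wPi: "w \<in> {1..n} \<rightarrow>\<^sub>E {..<2 * N}"
    proof (rule PiE_I)
      fix j assume "j \<in> {1..n}"
      then obtain i where i: "i \<in> {1..n}" "j = \<sigma> i" using \<sigma>ex by blast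
      then show "w j \<in> {..<2 * N}" using w\<sigma>[of i] gN[of i] by (simp add: dn_def)
    qed (auto simp: w_def wd_def p(1))
    have step: "w (\<sigma> i) < w (\<sigma> (Suc i)) \<or> w (\<sigma> i) = w (\<sigma> (Suc i)) \<and> \<sigma> i < \<sigma> (Suc i)" if i: "i \<in> {1..<n}" for i
    proof -
      have i': "i \<in> {1..n}" "Suc i \<in> {1..n}" using i by auto
      have g: "g i \<le> g (Suc i)" "i \<in> dex_set n \<sigma> \<Longrightarrow> g i < g (Suc i)"
        using p(4) i by (auto simp: chain_funs_def)
      have ne: "\<sigma> i \<noteq> \<sigma> (Suc i)" by (simp add: inj_eq[OF permutes_inj[OF p(2)]])
      show ?thesis
      proof (cases "i \<in> dex_set n \<sigma>")
        case True
        then show ?thesis using g(2) w\<sigma>[OF i'(1)] w\<sigma>[OF i'(2)] by (simp add: dn_def)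
      next
        case False
        then show ?thesis using i ne g(1) w\<sigma>[OF i'(1)] w\<sigma>[OF i'(2)] p(3)[OF i'(1)] p(3)[OF i'(2)]
          by (auto simp: dex_set_def dn_def)
      qed
    qed
    have mono: "w (\<sigma> i) < w (\<sigma> k) \<or> w (\<sigma> i) = w (\<sigma> k) \<and> \<sigma> i \<le> \<sigma> k" if "i \<le> k" "1 \<le> i" "k \<le> n" for i k
      using that(1,3)
    proof (induction rule: dec_induct)
      case (step m)
      then show ?case using \<open>1 \<le> i\<close> \<open>\<And>i. i \<in> {1..<n} \<Longrightarrow> _\<close>[of m] by auto
    qed simp
    have rank: "word_rank n w (\<sigma> i) = i" if i: "i \<in> {1..n}" for i
    proof -
      have "{j \<in> {1..n}. w j < w (\<sigma> i) \<or> w j = w (\<sigma> i) \<and> j \<le> \<sigma> i} = \<sigma> ` {1..i}"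
      proof (intro equalityI subsetI)
        fix j assume j: "j \<in> {j \<in> {1..n}. w j < w (\<sigma> i) \<or> w j = w (\<sigma> i) \<and> j \<le> \<sigma> i}"
        then obtain k where k: "k \<in> {1..n}" "j = \<sigma> k" using \<sigma>ex by blast
        have "k \<le> i"
        proof (rule ccontr)
          assume "\<not> k \<le> i"
          then have "w (\<sigma> i) < w (\<sigma> k) \<or> w (\<sigma> i) = w (\<sigma> k) \<and> \<sigma> i \<le> \<sigma> k" using mono[of i k] i k by auto
          then have "\<sigma> i = \<sigma> k" using j k by auto
          then show False using \<open>\<not> k \<le> i\<close> by (simp add: inj_eq[OF permutes_inj[OF p(2)]])
        qed
        then show "j \<in> \<sigma> ` {1..i}" using k by auto
      next
        fix j assume "j \<in> \<sigma> ` {1..i}"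
        then obtain k where k: "k \<in> {1..i}" "j = \<sigma> k" by blast
        then show "j \<in> {j \<in> {1..n}. w j < w (\<sigma> i) \<or> w j = w (\<sigma> i) \<and> j \<le> \<sigma> i}"
          using mono[of k i] \<sigma>in[of k] i by auto
      qed
      then show ?thesis unfolding word_rank_def using permutes_inj_on[OF p(2)] by (simp add: card_image)
    qed
    have inv: "inv (rk w) = \<sigma>"
    proof (rule inv_unique_comp)
      have "rk w (\<sigma> i) = i" for i
      proof (cases "i \<in> {1..n}")
        case True
        then show ?thesis using rank[OF True] \<sigma>in[of i] by (simp only: rk_def if_True)
      next
        case False
        then have "\<sigma> i = i" by (rule permutes_not_in[OF p(2)])
        then show ?thesis using False by (simp only: rk_def if_False)
      qed
      then show c: "rk w \<circ> \<sigma> = id" by auto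
      then show "\<sigma> \<circ> rk w = id"
        using permutes_inv_o(2)[OF p(2)] permutes_inv_o(1)[OF p(2)] by (metis comp_assoc comp_id id_comp)
    qed
    show "wd p \<in> exc_words n N"
    proof -
      have "(even (w j) \<longrightarrow> word_rank n w j < j) \<and> (odd (w j) \<longrightarrow> j < word_rank n w j)" if j: "j \<in> {1..n}" for j
      proof -
        obtain i where i: "i \<in> {1..n}" "j = \<sigma> i" using \<sigma>ex[OF j] by blast
        then show ?thesis using rank[of i] w\<sigma>[of i] p(3)[of i] by (auto simp: dn_def split: if_splits)
      qed
      then show ?thesis using exc_words_iff_rank[OF wPi] by (simp add: w_def)
    qed
    have "(\<lambda>i\<in>{1..n}. w (\<sigma> i) div 2) = g"
    proof
      fix i show "(\<lambda>i\<in>{1..n}. w (\<sigma> i) div 2) i = g i"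
      proof (cases "i \<in> {1..n}")
        case True
        then show ?thesis using w\<sigma>[OF True] by (simp add: dn_def)
      next
        case False
        then show ?thesis using p(4) by (auto simp: chain_funs_def PiE_def extensional_def)
      qed
    qed
    then have "un w = (\<sigma>, g)" unfolding un_def inv by simp
    then show "un (wd p) = p" by (simp only: w_def p(1))
    have "(\<Prod>j=1..n. exc_letter_weight t x (w j)) = (\<Prod>i=1..n. exc_letter_weight t x (w (\<sigma> i)))"
      using permutes_imp_bij[OF p(2)] by (rule prod.reindex_bij_betw[symmetric])
    also have "\<dots> = (\<Prod>i=1..n. (if \<sigma> i > i then t else 1) * x (g i))"
    proof (rule prod.cong[OF refl])
      fix i assume i: "i \<in> {1..n}"
      show "exc_letter_weight t x (w (\<sigma> i)) = (if \<sigma> i > i then t else 1) * x (g i)"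
        using p(3)[OF i] unfolding w\<sigma>[OF i] by (auto simp: exc_letter_weight_def dn_def)
    qed
    also have "\<dots> = t ^ perm_exc n \<sigma> * (\<Prod>i=1..n. x (g i))"
      by (simp add: prod.distrib perm_exc_def prod.If_cases Int_def)
    finally show "(\<Prod>j=1..n. exc_letter_weight t x (wd p j)) = (case p of (\<sigma>, g) \<Rightarrow> t ^ perm_exc n \<sigma> * (\<Prod>i=1..n. x (g i)))"
      by (simp add: p(1) w_def)
  next
    fix w assume w: "w \<in> exc_words n N"
    then have wPi: "w \<in> {1..n} \<rightarrow>\<^sub>E {..<2 * N}" by (simp add: exc_words_def)
    define \<sigma> where "\<sigma> = inv (rk w)"
    define g where "g = (\<lambda>i\<in>{1..n}. w (\<sigma> i) div 2)"
    have un: "un w = (\<sigma>, g)" by (simp add: un_def \<sigma>_def g_def)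
    have \<sigma>: "\<sigma> permutes {1..n}" unfolding \<sigma>_def by (rule permutes_inv[OF rk_perm])
    have \<sigma>in: "\<sigma> i \<in> {1..n}" if "i \<in> {1..n}" for i using permutes_in_image[OF \<sigma>] that by blast
    have rank\<sigma>: "word_rank n w (\<sigma> i) = i" if "i \<in> {1..n}" for i
    proof -
      have "rk w (\<sigma> i) = i" unfolding \<sigma>_def using permutes_inverses(1)[OF rk_perm] .
      then show ?thesis using \<sigma>in[OF that] by (simp only: rk_def if_True)
    qed
    have ev: "even (w (\<sigma> i)) \<Longrightarrow> i < \<sigma> i" and od: "odd (w (\<sigma> i)) \<Longrightarrow> \<sigma> i < i" if "i \<in> {1..n}" for i
      using bspec[OF iffD1[OF exc_words_iff_rank[OF wPi] w] \<sigma>in[OF that]] unfolding rank\<sigma>[OF that] by auto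
    have der: "\<sigma> \<in> derangements n" using \<sigma> ev od by (fastforce simp: derangements_def)
    have "g \<in> chain_funs n N (dex_set n \<sigma>)"
    proof -
      have "w (\<sigma> i) < 2 * N" if "i \<in> {1..n}" for i using wPi \<sigma>in[OF that] by auto
      then have "w (\<sigma> i) div 2 < N" if "i \<in> {1..n}" for i using that by (simp add: less_mult_imp_div_less mult.commute)
      then have "g \<in> {1..n} \<rightarrow>\<^sub>E {..<N}" by (auto simp: g_def)
      moreover have "g i \<le> g (Suc i) \<and> (i \<in> dex_set n \<sigma> \<longrightarrow> g i < g (Suc i))" if i: "i \<in> {1..<n}" for i
      proof -
        have i': "i \<in> {1..n}" "Suc i \<in> {1..n}" using i by auto
        have lt: "w (\<sigma> i) < w (\<sigma> (Suc i)) \<or> w (\<sigma> i) = w (\<sigma> (Suc i)) \<and> \<sigma> i \<le> \<sigma> (Suc i)"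
          using word_rank_mono_iff[OF \<sigma>in[OF i'(1)] \<sigma>in[OF i'(2)], of w] rank\<sigma>[OF i'(1)] rank\<sigma>[OF i'(2)] by simp
        have gi: "g i = w (\<sigma> i) div 2" "g (Suc i) = w (\<sigma> (Suc i)) div 2" using i' by (auto simp: g_def)
        have le: "g i \<le> g (Suc i)" using lt unfolding gi by (auto intro: div_le_mono)
        moreover have "g i < g (Suc i)" if dex: "i \<in> dex_set n \<sigma>"
        proof -
          have ud: "even (w (\<sigma> i)) \<longleftrightarrow> i < \<sigma> i" "even (w (\<sigma> (Suc i))) \<longleftrightarrow> Suc i < \<sigma> (Suc i)"
            using ev[OF i'(1)] od[OF i'(1)] ev[OF i'(2)] od[OF i'(2)] by (meson less_asym)+
          \<comment> \<open>Two increasing letters have the same half only if the first is even and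
            the second odd, which is the one change of type that \<open>dex_set\<close> does not
            contain.\<close>
          have "w (\<sigma> i) < w (\<sigma> (Suc i)) \<and> (even (w (\<sigma> i)) \<longrightarrow> even (w (\<sigma> (Suc i))))"
            using dex lt ud by (auto simp: dex_set_def)
          then show ?thesis unfolding gi by presburger
        qed
        ultimately show ?thesis by blast
      qed
      ultimately show ?thesis by (auto simp: chain_funs_def)
    qed
    then show "un w \<in> ?X" using der un by auto
    show "wd (un w) = w"
    proof
      fix j show "wd (un w) j = w j"
      proof (cases "j \<in> {1..n}")
        case True
        define i where "i = inv \<sigma> j"
        have i: "i \<in> {1..n}" "\<sigma> i = j" using True \<sigma> permutes_inv[OF \<sigma>]
          by (auto simp: i_def permutes_inverses permutes_in_image simp del: atLeastAtMost_iff)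
        have "wd (un w) j = 2 * (w j div 2) + dn i j" using True i by (simp add: wd_def un g_def flip: i_def)
        also have "\<dots> = w j" using ev[OF i(1)] od[OF i(1)] i(2) by (cases "even (w j)") (auto simp: dn_def)
        finally show ?thesis .
      next
        case False
        then have "w j = undefined" using wPi by (auto simp: PiE_def extensional_def)
        then show ?thesis using False unfolding un wd_def by (simp only: split restrict_apply if_False)
      qed
    qed
  qed
  finally show ?thesis .
qed

section \<open>Counting words by content\<close>

text \<open>
  The lower bound for the letter \<open>2 b\<close> is written as no condition (letter \<open>3 b + 1\<close>) minus the opposite
  upper bound (letter \<open>3 b\<close>, with a sign); \<open>2 b + 1\<close> becomes \<open>3 b + 2\<close>.
\<close>

definition signed_words :: "nat \<Rightarrow> nat \<Rightarrow> (nat \<Rightarrow> nat) set" where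
  "signed_words n N = {v \<in> {1..n} \<rightarrow>\<^sub>E {..<3 * N}. \<forall>j\<in>{1..n}.
     (v j mod 3 = 0 \<longrightarrow> j \<le> word_less n v (v j) + 1) \<and> (v j mod 3 = 2 \<longrightarrow> j < word_less n v (Suc (v j)))}"

definition signed_letter_weight :: "'a::comm_ring_1 \<Rightarrow> (nat \<Rightarrow> 'a) \<Rightarrow> nat \<Rightarrow> 'a" where
  "signed_letter_weight t x r =
     (if r mod 3 = 0 then - t * x (r div 3) else if r mod 3 = 1 then t * x (r div 3) else x (r div 3))"

lemma finite_signed_words [simp]: "finite (signed_words n N)"
  by (rule finite_subset[of _ "{1..n} \<rightarrow>\<^sub>E {..<3 * N}"]) (auto simp: signed_words_def intro: finite_PiE)

definition merge_letter :: "nat \<Rightarrow> nat" where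
  "merge_letter r = 2 * (r div 3) + (if r mod 3 = 2 then 1 else 0)"

lemma merge_letter_simps:
  "merge_letter (3 * c) = 2 * c" "merge_letter (3 * c + 1) = 2 * c" "merge_letter (3 * c + 2) = 2 * c + 1"
proof -
  have "(3 * c + 1) div 3 = c" "(3 * c + 1) mod 3 = 1" "(3 * c + 2) div 3 = c" "(3 * c + 2) mod 3 = 2" by presburger+
  then show "merge_letter (3 * c) = 2 * c" "merge_letter (3 * c + 1) = 2 * c" "merge_letter (3 * c + 2) = 2 * c + 1"
    unfolding merge_letter_def by simp_all
qed

lemma mod_3_cases:
  obtains c where "r = 3 * c" | c where "r = 3 * c + 1" | c where "r = 3 * c + (2::nat)"
proof -
  have "r = 3 * (r div 3) \<or> r = 3 * (r div 3) + 1 \<or> r = 3 * (r div 3) + 2" by presburger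
  then show ?thesis using that by blast
qed

text \<open>Merging is weakly increasing and identifies only 3c with 3c + 1. The bounds in
  \<open>signed_words\<close> compare letters with the multiples 3c and 3c + 3 of 3 alone, so the
  numbers of smaller letters survive the merging.\<close>

lemma merge_letter_less: "merge_letter a < merge_letter (3 * c) \<longleftrightarrow> a < 3 * c"
  by (cases a rule: mod_3_cases) (simp_all only: merge_letter_simps, linarith+)

lemma merge_letter_less_Suc: "merge_letter a < Suc (merge_letter (3 * c + 2)) \<longleftrightarrow> a < Suc (3 * c + 2)"
  by (cases a rule: mod_3_cases) (simp_all only: merge_letter_simps, linarith+)

lemma merge_letter_eq_even: "merge_letter a = 2 * c \<longleftrightarrow> a = 3 * c \<or> a = 3 * c + 1"
  by (cases a rule: mod_3_cases) (simp_all only: merge_letter_simps, presburger+)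

lemma merge_letter_eq_odd: "merge_letter a = 2 * c + 1 \<longleftrightarrow> a = 3 * c + 2"
  by (cases a rule: mod_3_cases) (simp_all only: merge_letter_simps, presburger+)

lemma merge_letter_bound: "a < 3 * N \<Longrightarrow> merge_letter a < 2 * N"
  using merge_letter_less[of a N] by (simp only: merge_letter_simps)

lemma sum_exc_words_eq_signed:
  fixes t :: "'a::comm_ring_1"
  shows "(\<Sum>w\<in>exc_words n N. \<Prod>j=1..n. exc_letter_weight t x (w j)) =
    (\<Sum>v\<in>signed_words n N. \<Prod>j=1..n. signed_letter_weight t x (v j))"
proof -
  let ?W = "{1..n} \<rightarrow>\<^sub>E {..<2 * N}" and ?V = "{1..n} \<rightarrow>\<^sub>E {..<3 * N}"
  let ?y = "signed_letter_weight t x"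
  define fib where "fib = (\<lambda>b. {r \<in> {..<3 * N}. merge_letter r = b})"
  \<comment> \<open>The counts refer to the merged word \<open>w\<close>, which stays fixed while a
    preimage of each letter is chosen. Hence the condition at one position ignores the choices at
    the others, and the product of sums can be expanded. The fact \<open>signed\<close> identifies
    the counts with those of \<open>v\<close>.\<close>
  define ok where "ok = (\<lambda>w j (r::nat). (r mod 3 = 0 \<longrightarrow> j \<le> word_less n w (w j) + 1) \<and> (r mod 3 = 2 \<longrightarrow> j < word_less n w (Suc (w j))))"
  define mg where "mg = (\<lambda>v. \<lambda>j\<in>{1..n}. merge_letter (v j))"
  have finW: "finite ?W" and finV: "finite ?V" by (auto intro: finite_PiE)
  have fib_even: "fib (2 * c) = {3 * c, 3 * c + 1}" if "c < N" for c
  proof -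
    show ?thesis unfolding fib_def merge_letter_eq_even using that by auto
  qed
  have fib_odd: "fib (2 * c + 1) = {3 * c + 2}" if "c < N" for c
  proof -
    show ?thesis unfolding fib_def merge_letter_eq_odd using that by auto
  qed
  have single: "(\<Sum>r\<in>fib (w j). if ok w j r then ?y r else 0) =
     (if (even (w j) \<longrightarrow> word_less n w (w j) + 2 \<le> j) \<and> (odd (w j) \<longrightarrow> j < word_less n w (Suc (w j)))
      then exc_letter_weight t x (w j) else 0)" if "w j < 2 * N" for w j
  proof (cases "even (w j)")
    case True
    then obtain c where c: "w j = 2 * c" by blast
    then have "c < N" using that by simp
    note f = fib_even[OF this]
    have m: "(3 * c) mod 3 = 0" "(3 * c) div 3 = c" "(3 * c + 1) mod 3 = 1" "(3 * c + 1) div 3 = c" by presburger+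
    have "(\<Sum>r\<in>fib (w j). if ok w j r then ?y r else 0) = (if ok w j (3 * c) then ?y (3 * c) else 0) + (if ok w j (3 * c + 1) then ?y (3 * c + 1) else 0)"
      unfolding c f by simp
    also have "\<dots> = (if j \<le> word_less n w (w j) + 1 then - t * x c else 0) + t * x c"
      unfolding ok_def signed_letter_weight_def m by simp
    also have "\<dots> = (if word_less n w (w j) + 2 \<le> j then t * x c else 0)" by simp
    finally show ?thesis using True c by (simp add: exc_letter_weight_def)
  next
    case False
    then obtain c where c: "w j = 2 * c + 1" by (elim oddE)
    then have "c < N" using that by simp
    note f = fib_odd[OF this]
    have m: "(3 * c + 2) mod 3 = 2" "(3 * c + 2) div 3 = c" "(2 * c + 1) div 2 = c" by presburger+
    have "(\<Sum>r\<in>fib (w j). if ok w j r then ?y r else 0) = (if ok w j (3 * c + 2) then ?y (3 * c + 2) else 0)"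
      unfolding c f by simp
    also have "\<dots> = (if j < word_less n w (Suc (w j)) then x c else 0)"
      unfolding ok_def signed_letter_weight_def m by simp
    also have "\<dots> = (if (even (w j) \<longrightarrow> word_less n w (w j) + 2 \<le> j) \<and> (odd (w j) \<longrightarrow> j < word_less n w (Suc (w j)))
      then exc_letter_weight t x (w j) else 0)"
      using False unfolding exc_letter_weight_def by (simp add: c m)
    finally show ?thesis .
  qed
  have signed: "(\<Prod>j=1..n. if ok w j (v j) then ?y (v j) else 0) = (if v \<in> signed_words n N then \<Prod>j=1..n. ?y (v j) else 0)"
    if v: "v \<in> ?V" and w: "mg v = w" for v w
  proof -
    have wj: "w j = merge_letter (v j)" if "j \<in> {1..n}" for j using that w by (auto simp: mg_def)
    have less: "word_less n w (w j) = word_less n v (v j)" if "j \<in> {1..n}" "v j mod 3 = 0" for j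
    proof -
      have "v j = 3 * (v j div 3)" using that(2) by presburger
      then have "w i < w j \<longleftrightarrow> v i < v j" if "i \<in> {1..n}" for i
        using merge_letter_less[of "v i" "v j div 3"] wj[OF that] wj[OF \<open>j \<in> {1..n}\<close>] by metis
      then have "{i \<in> {1..n}. w i < w j} = {i \<in> {1..n}. v i < v j}" by blast
      then show ?thesis by (simp only: word_less_def)
    qed
    have le: "word_less n w (Suc (w j)) = word_less n v (Suc (v j))" if "j \<in> {1..n}" "v j mod 3 = 2" for j
    proof -
      have "v j = 3 * (v j div 3) + 2" using that(2) by presburger
      then have "w i < Suc (w j) \<longleftrightarrow> v i < Suc (v j)" if "i \<in> {1..n}" for i
        using merge_letter_less_Suc[of "v i" "v j div 3"] wj[OF that] wj[OF \<open>j \<in> {1..n}\<close>] by metis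
      then have "{i \<in> {1..n}. w i < Suc (w j)} = {i \<in> {1..n}. v i < Suc (v j)}" by blast
      then show ?thesis by (simp only: word_less_def)
    qed
    have "ok w j (v j) \<longleftrightarrow> (v j mod 3 = 0 \<longrightarrow> j \<le> word_less n v (v j) + 1) \<and> (v j mod 3 = 2 \<longrightarrow> j < word_less n v (Suc (v j)))"
      if "j \<in> {1..n}" for j using less le that by (auto simp: ok_def)
    then have iff: "v \<in> signed_words n N \<longleftrightarrow> (\<forall>j\<in>{1..n}. ok w j (v j))"
      using v by (simp add: signed_words_def)
    show ?thesis
    proof (cases "v \<in> signed_words n N")
      case True
      then show ?thesis using iff by simp
    next
      case False
      then obtain j where "j \<in> {1..n}" "\<not> ok w j (v j)" using iff by blast
      then show ?thesis using False by (intro trans[OF prod_zero]) auto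
    qed
  qed
  have "(\<Sum>w\<in>exc_words n N. \<Prod>j=1..n. exc_letter_weight t x (w j)) =
      (\<Sum>w\<in>?W. \<Prod>j=1..n. \<Sum>r\<in>fib (w j). if ok w j r then ?y r else 0)"
  proof (rule sum.mono_neutral_cong_left[OF finW])
    show "exc_words n N \<subseteq> ?W" by (auto simp: exc_words_def)
  next
    show "\<forall>w\<in>?W - exc_words n N. (\<Prod>j=1..n. \<Sum>r\<in>fib (w j). if ok w j r then ?y r else 0) = 0"
    proof
      fix w assume w: "w \<in> ?W - exc_words n N"
      then obtain j where j: "j \<in> {1..n}" "\<not> ((even (w j) \<longrightarrow> word_less n w (w j) + 2 \<le> j) \<and> (odd (w j) \<longrightarrow> j < word_less n w (Suc (w j))))"
        unfolding exc_words_def by blast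
      have "w j < 2 * N" using w j(1) by auto
      from single[of w j, OF this] j have "(\<Sum>r\<in>fib (w j). if ok w j r then ?y r else 0) = 0" by (simp only: if_False)
      then show "(\<Prod>j=1..n. \<Sum>r\<in>fib (w j). if ok w j r then ?y r else 0) = 0"
        using j(1) by (intro prod_zero) auto
    qed
  next
    fix w assume w: "w \<in> exc_words n N"
    show "(\<Prod>j=1..n. exc_letter_weight t x (w j)) = (\<Prod>j=1..n. \<Sum>r\<in>fib (w j). if ok w j r then ?y r else 0)"
    proof (rule prod.cong[OF refl])
      fix j assume j: "j \<in> {1..n}"
      then have "w j < 2 * N" using w by (auto simp: exc_words_def)
      from single[of w j, OF this] show "exc_letter_weight t x (w j) = (\<Sum>r\<in>fib (w j). if ok w j r then ?y r else 0)"
        using w j by (simp add: exc_words_def)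
    qed
  qed
  also have "\<dots> = (\<Sum>w\<in>?W. \<Sum>v\<in>{v \<in> ?V. mg v = w}. if v \<in> signed_words n N then \<Prod>j=1..n. ?y (v j) else 0)"
  proof (rule sum.cong[OF refl])
    fix w assume w: "w \<in> ?W"
    have eq: "PiE {1..n} (\<lambda>j. fib (w j)) = {v \<in> ?V. mg v = w}"
    proof (intro equalityI subsetI)
      fix v assume v: "v \<in> PiE {1..n} (\<lambda>j. fib (w j))"
      have "mg v j = w j" for j
        using v w by (cases "j \<in> {1..n}") (auto simp: mg_def fib_def PiE_def Pi_def extensional_def)
      moreover have "v \<in> ?V" using v by (auto simp: fib_def PiE_def Pi_def)
      ultimately show "v \<in> {v \<in> ?V. mg v = w}" by blast
    next
      fix v assume "v \<in> {v \<in> ?V. mg v = w}"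
      then show "v \<in> PiE {1..n} (\<lambda>j. fib (w j))" by (auto simp: mg_def fib_def PiE_def Pi_def)
    qed
    have "(\<Prod>j=1..n. \<Sum>r\<in>fib (w j). if ok w j r then ?y r else 0) =
      (\<Sum>v\<in>PiE {1..n} (\<lambda>j. fib (w j)). \<Prod>j=1..n. if ok w j (v j) then ?y (v j) else 0)"
      by (rule prod_sum_PiE) (auto simp: fib_def)
    also have "\<dots> = (\<Sum>v\<in>{v \<in> ?V. mg v = w}. if v \<in> signed_words n N then \<Prod>j=1..n. ?y (v j) else 0)"
      unfolding eq by (intro sum.cong refl signed) auto
    finally show "(\<Prod>j=1..n. \<Sum>r\<in>fib (w j). if ok w j r then ?y r else 0) =
      (\<Sum>v\<in>{v \<in> ?V. mg v = w}. if v \<in> signed_words n N then \<Prod>j=1..n. ?y (v j) else 0)" .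
  qed
  also have "\<dots> = (\<Sum>v\<in>?V. if v \<in> signed_words n N then \<Prod>j=1..n. ?y (v j) else 0)"
  proof (rule sum.group[OF finV finW])
    show "mg ` ?V \<subseteq> ?W" by (auto simp: mg_def PiE_def Pi_def merge_letter_bound)
  qed
  also have "\<dots> = (\<Sum>v\<in>signed_words n N. \<Prod>j=1..n. ?y (v j))"
    by (rule sum.mono_neutral_cong_right[OF finV]) (auto simp: signed_words_def)
  finally show ?thesis .
qed

section \<open>Filling the positions letter by letter\<close>

text \<open>
  Partial words with prescribed content in which \<open>z\<close> stands for an empty position.
\<close>

definition fillings :: "nat \<Rightarrow> (nat \<Rightarrow> nat set) \<Rightarrow> (nat \<Rightarrow> nat) \<Rightarrow> nat \<Rightarrow> nat set \<Rightarrow> (nat \<Rightarrow> nat) set" where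
  "fillings n B \<kappa> z L = {u \<in> {1..n} \<rightarrow>\<^sub>E insert z L. \<forall>l\<in>L.
     card {j \<in> {1..n}. u j = l} = \<kappa> l \<and> (\<forall>j\<in>{1..n}. u j = l \<longrightarrow> j \<in> B l)}"

lemma finite_fillings: "finite L \<Longrightarrow> finite (fillings n B \<kappa> z L)"
  by (rule finite_subset[of _ "{1..n} \<rightarrow>\<^sub>E insert z L"]) (auto simp: fillings_def intro: finite_PiE)

lemma card_filled:
  fixes u \<kappa> :: "nat \<Rightarrow> nat"
  assumes "finite L" "\<And>l. l \<in> L \<Longrightarrow> card {j \<in> {1..n}. u j = l} = \<kappa> l"
  shows "card {j \<in> {1..n}. u j \<in> L} = sum \<kappa> L"
proof -
  have "{j \<in> {1..n}. u j \<in> L} = (\<Union>l\<in>L. {j \<in> {1..n}. u j = l})" by auto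
  also have "card \<dots> = (\<Sum>l\<in>L. card {j \<in> {1..n}. u j = l})"
  proof (rule card_UN_disjoint[OF assms(1)])
    show "\<forall>l\<in>L. finite {j \<in> {1..n}. u j = l}" by simp
  qed auto
  finally show ?thesis using assms by simp
qed

text \<open>The copies of \<open>l\<close> go to empty positions of \<open>B l\<close>. By
  \<open>sub\<close> all filled positions lie in \<open>B l\<close>, so the number of empty ones
  there is the same for every filling. The guard \<open>0 < \<kappa> l\<close> matters for letters
  3b + 2: with multiplicity 0 their strict bound may miss a filled position, but then the binomial
  coefficient is 1 anyway.\<close>

lemma card_fillings_insert:
  assumes L: "finite L" "l \<notin> L" "l \<noteq> z" "z \<notin> L" and B: "B l \<subseteq> {1..n}"
    and sub: "\<And>u j. 0 < \<kappa> l \<Longrightarrow> u \<in> fillings n B \<kappa> z L \<Longrightarrow> j \<in> {1..n} \<Longrightarrow> u j \<in> L \<Longrightarrow> j \<in> B l"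
  shows "card (fillings n B \<kappa> z (insert l L)) = card (fillings n B \<kappa> z L) * ((card (B l) - sum \<kappa> L) choose \<kappa> l)"
proof -
  let ?F = "fillings n B \<kappa> z L"
  let ?S = "\<lambda>u. {S. S \<subseteq> {j \<in> B l. u j = z} \<and> card S = \<kappa> l}"
  let ?f = "\<lambda>u. (\<lambda>j\<in>{1..n}. if u j = l then z else u j, {j \<in> {1..n}. u j = l})"
  let ?g = "\<lambda>(u, S). \<lambda>j\<in>{1..n}. if j \<in> S then l else u j"
  have finB: "finite (B l)" using B finite_subset by blast
  have "bij_betw ?f (fillings n B \<kappa> z (insert l L)) (Sigma ?F ?S)"
  proof (rule bij_betw_byWitness[where f' = ?g])
    show "\<forall>u\<in>fillings n B \<kappa> z (insert l L). ?g (?f u) = u"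
    proof
      fix u assume "u \<in> fillings n B \<kappa> z (insert l L)"
      then have "u \<in> extensional {1..n}" by (auto simp: fillings_def PiE_def)
      then show "?g (?f u) = u" by (auto simp: fun_eq_iff extensional_def)
    qed
    show "\<forall>p\<in>Sigma ?F ?S. ?f (?g p) = p"
    proof
      fix p assume "p \<in> Sigma ?F ?S"
      then obtain u S where p: "p = (u, S)" "u \<in> ?F" "S \<subseteq> {j \<in> B l. u j = z}" by auto
      have u: "u j \<in> insert z L" if "j \<in> {1..n}" for j using p(2) that by (auto simp: fillings_def)
      have ext: "u \<in> extensional {1..n}" using p(2) by (auto simp: fillings_def PiE_def)
      have nl: "u j \<noteq> l" if "j \<in> {1..n}" for j using u[OF that] L by auto
      have "(\<lambda>j\<in>{1..n}. if (?g p) j = l then z else (?g p) j) = u"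
        using ext p(1,3) nl by (auto simp: fun_eq_iff extensional_def)
      moreover have "{j \<in> {1..n}. (?g p) j = l} = S"
        using p(1,3) nl B by auto
      ultimately show "?f (?g p) = p" using p(1) by simp
    qed
    show "?f ` fillings n B \<kappa> z (insert l L) \<subseteq> Sigma ?F ?S"
    proof
      fix p assume "p \<in> ?f ` fillings n B \<kappa> z (insert l L)"
      then obtain u where p: "p = ?f u" and u: "u \<in> fillings n B \<kappa> z (insert l L)" by blast
      have ul: "u j \<in> insert z (insert l L)" if "j \<in> {1..n}" for j using u that by (auto simp: fillings_def)
      define u' where "u' = (\<lambda>j\<in>{1..n}. if u j = l then z else u j)"
      have eq: "{j \<in> {1..n}. u' j = k} = {j \<in> {1..n}. u j = k}" if "k \<in> L" for k
        using that L by (auto simp: u'_def)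
      have "u' \<in> {1..n} \<rightarrow>\<^sub>E insert z L"
      proof (rule PiE_I)
        fix j assume j: "j \<in> {1..n}"
        then show "u' j \<in> insert z L" using ul[OF j] by (auto simp: u'_def)
      qed (auto simp: u'_def)
      moreover have "card {j \<in> {1..n}. u' j = k} = \<kappa> k \<and> (\<forall>j\<in>{1..n}. u' j = k \<longrightarrow> j \<in> B k)" if "k \<in> L" for k
      proof -
        have k: "card {j \<in> {1..n}. u j = k} = \<kappa> k" "\<forall>j\<in>{1..n}. u j = k \<longrightarrow> j \<in> B k"
          using u that by (auto simp: fillings_def)
        have "j \<in> B k" if "j \<in> {1..n}" "u' j = k" for j
        proof -
          have "j \<in> {j \<in> {1..n}. u j = k}" unfolding eq[OF \<open>k \<in> L\<close>, symmetric] using that by blast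
          then show ?thesis using k(2) by blast
        qed
        then show ?thesis using k(1) eq[OF that] by simp
      qed
      ultimately have 1: "u' \<in> ?F" by (simp add: fillings_def)
      have "\<forall>j\<in>{1..n}. u j = l \<longrightarrow> j \<in> B l" and 2: "card {j \<in> {1..n}. u j = l} = \<kappa> l"
        using u by (auto simp: fillings_def)
      then have "{j \<in> {1..n}. u j = l} \<subseteq> {j \<in> B l. u' j = z}" by (auto simp: u'_def)
      with 1 2 have "(u', {j \<in> {1..n}. u j = l}) \<in> Sigma ?F ?S" by blast
      then show "p \<in> Sigma ?F ?S" by (simp only: p u'_def)
    qed
    show "?g ` Sigma ?F ?S \<subseteq> fillings n B \<kappa> z (insert l L)"
    proof
      fix v assume "v \<in> ?g ` Sigma ?F ?S"
      then obtain u S where p: "v = ?g (u, S)" "u \<in> ?F" "S \<subseteq> {j \<in> B l. u j = z}" "card S = \<kappa> l" by auto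
      have u: "u j \<in> insert z L" if "j \<in> {1..n}" for j using p(2) that by (auto simp: fillings_def)
      have nl: "u j \<noteq> l" if "j \<in> {1..n}" for j using u[OF that] L by auto
      have Sl: "{j \<in> {1..n}. v j = l} = S" using p(1,3) nl B by auto
      have other: "{j \<in> {1..n}. v j = k} = {j \<in> {1..n}. u j = k}" if "k \<in> L" for k
        using that p(1,3) L by auto
      have "v \<in> {1..n} \<rightarrow>\<^sub>E insert z (insert l L)"
      proof (rule PiE_I)
        fix j assume j: "j \<in> {1..n}"
        then show "v j \<in> insert z (insert l L)" using u[OF j] p(1) by auto
      qed (use p(1) in auto)
      moreover have "card {j \<in> {1..n}. v j = k} = \<kappa> k \<and> (\<forall>j\<in>{1..n}. v j = k \<longrightarrow> j \<in> B k)" if k: "k \<in> insert l L" for k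
      proof (cases "k = l")
        case True
        then show ?thesis using Sl p(3,4) by blast
      next
        case False
        then have "k \<in> L" using k by simp
        then have k: "card {j \<in> {1..n}. u j = k} = \<kappa> k" "\<forall>j\<in>{1..n}. u j = k \<longrightarrow> j \<in> B k"
          using p(2) by (auto simp: fillings_def)
        have "j \<in> B k" if "j \<in> {1..n}" "v j = k" for j
        proof -
          have "j \<in> {j \<in> {1..n}. u j = k}" unfolding other[OF \<open>k \<in> L\<close>, symmetric] using that by blast
          then show ?thesis using k(2) by blast
        qed
        then show ?thesis using k(1) other[OF \<open>k \<in> L\<close>] by simp
      qed
      ultimately show "v \<in> fillings n B \<kappa> z (insert l L)" by (simp add: fillings_def)
    qed
  qed
  then have "card (fillings n B \<kappa> z (insert l L)) = card (Sigma ?F ?S)" by (rule bij_betw_same_card)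
  also have "\<dots> = (\<Sum>u\<in>?F. card (?S u))"
    by (rule card_SigmaI) (use finite_fillings[OF L(1)] finB in auto)
  also have "\<dots> = (\<Sum>u\<in>?F. (card (B l) - sum \<kappa> L) choose \<kappa> l)"
  proof (rule sum.cong[OF refl])
    fix u assume u: "u \<in> ?F"
    have "card (?S u) = card {j \<in> B l. u j = z} choose \<kappa> l" by (rule n_subsets) (use finB in simp)
    also have "\<dots> = (card (B l) - sum \<kappa> L) choose \<kappa> l"
    proof (cases "\<kappa> l = 0")
      case False
      have uin: "u j \<in> insert z L" if "j \<in> {1..n}" for j using u that by (auto simp: fillings_def)
      have "{j \<in> B l. u j = z} = B l - {j \<in> {1..n}. u j \<in> L}" using uin B L(4) by blast
      moreover have "{j \<in> {1..n}. u j \<in> L} \<subseteq> B l" using sub[OF _ u] False by auto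
      moreover have "card {j \<in> {1..n}. u j \<in> L} = sum \<kappa> L"
        by (rule card_filled[OF L(1)]) (use u in \<open>auto simp: fillings_def\<close>)
      ultimately show ?thesis by (simp add: card_Diff_subset)
    qed simp
    finally show "card (?S u) = (card (B l) - sum \<kappa> L) choose \<kappa> l" .
  qed
  finally show ?thesis by simp
qed

definition free_sum :: "(nat \<Rightarrow> nat) \<Rightarrow> nat \<Rightarrow> nat" where
  "free_sum \<kappa> r = sum \<kappa> {k \<in> {..<r}. k mod 3 = 1}"

text \<open>A bounded letter finds as many empty positions as its bound allows minus the smaller
  bounded letters. In this difference the bounded letters cancel, and only the smaller free ones
  remain, plus 1 or \<open>\<kappa> r - 1\<close> from the bound itself. A free letter, placed after
  all bounded and all larger free ones, finds room for itself and the smaller free letters.\<close>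

definition letter_choices :: "(nat \<Rightarrow> nat) \<Rightarrow> nat \<Rightarrow> nat" where
  "letter_choices \<kappa> r =
     (if r mod 3 = 0 then (free_sum \<kappa> r + 1) choose \<kappa> r
      else if r mod 3 = 1 then free_sum \<kappa> (Suc r) choose \<kappa> r
      else (free_sum \<kappa> r + \<kappa> r - 1) choose \<kappa> r)"

lemma free_sum_0 [simp]: "free_sum \<kappa> 0 = 0"
  by (simp add: free_sum_def)

lemma free_sum_Suc: "free_sum \<kappa> (Suc r) = free_sum \<kappa> r + (if r mod 3 = 1 then \<kappa> r else 0)"
proof -
  have "{k \<in> {..<Suc r}. k mod 3 = 1} = (if r mod 3 = 1 then insert r {k \<in> {..<r}. k mod 3 = 1} else {k \<in> {..<r}. k mod 3 = 1})"
    by (auto simp: less_Suc_eq)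
  then show ?thesis by (simp add: free_sum_def)
qed

lemma sum_nonfree: "sum \<kappa> {k \<in> {..<r}. k mod 3 \<noteq> 1} + free_sum \<kappa> r = sum \<kappa> {..<r::nat}"
proof -
  have "{..<r} = {k \<in> {..<r}. k mod 3 \<noteq> 1} \<union> {k \<in> {..<r}. k mod 3 = 1}" by auto
  then have "sum \<kappa> {..<r} = sum \<kappa> ({k \<in> {..<r}. k mod 3 \<noteq> 1} \<union> {k \<in> {..<r}. k mod 3 = 1})" by (rule arg_cong)
  also have "\<dots> = sum \<kappa> {k \<in> {..<r}. k mod 3 \<noteq> 1} + sum \<kappa> {k \<in> {..<r}. k mod 3 = 1}"
    by (rule sum.union_disjoint) auto
  finally show ?thesis by (simp add: free_sum_def)
qed

definition word_content :: "nat \<Rightarrow> (nat \<Rightarrow> nat) \<Rightarrow> nat \<Rightarrow> nat" where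
  "word_content n v r = card {j \<in> {1..n}. v j = r}"

text \<open>Once the content is fixed, \<open>word_less\<close> is a partial sum of it, and the
  conditions on a signed word become fixed sets of admissible positions.\<close>

definition letter_bound :: "nat \<Rightarrow> (nat \<Rightarrow> nat) \<Rightarrow> nat \<Rightarrow> nat set" where
  "letter_bound n \<kappa> r = {j \<in> {1..n}. (r mod 3 = 0 \<longrightarrow> j \<le> sum \<kappa> {..<r} + 1) \<and> (r mod 3 = 2 \<longrightarrow> j < sum \<kappa> {..<Suc r})}"

text \<open>
  The bounded letters are placed first, in increasing order, so that all filled positions lie within the next
  bound; the unbounded letters \<open>3 b + 1\<close> follow in decreasing order.
\<close>

lemma card_fillings_all:
  assumes n: "sum \<kappa> {..<M} = n"
  shows "card (fillings n (letter_bound n \<kappa>) \<kappa> M {..<M}) = (\<Prod>r<M. letter_choices \<kappa> r)"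
proof -
  let ?F = "fillings n (letter_bound n \<kappa>) \<kappa> M"
  let ?s = "\<lambda>r. sum \<kappa> {..<r}"
  have smono: "?s a \<le> ?s b" if "a \<le> b" for a b using that by (intro sum_mono2) auto
  have lb: "letter_bound n \<kappa> r \<subseteq> {1..n}" for r by (auto simp: letter_bound_def)
  have nonfree: "card (?F {k \<in> {..<r}. k mod 3 \<noteq> 1}) = (\<Prod>k\<in>{k \<in> {..<r}. k mod 3 \<noteq> 1}. letter_choices \<kappa> k)" if "r \<le> M" for r
    using that
  proof (induction r)
    case 0
    have "?F {} = {\<lambda>j\<in>{1..n}. M}" by (auto simp: fillings_def fun_eq_iff PiE_def extensional_def)
    then show ?case by simp
  next
    case (Suc r)
    let ?L = "{k \<in> {..<r}. k mod 3 \<noteq> 1}"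
    show ?case
    proof (cases "r mod 3 = 1")
      case True
      then have "{k \<in> {..<Suc r}. k mod 3 \<noteq> 1} = ?L" by (auto simp: less_Suc_eq)
      then show ?thesis using Suc by simp
    next
      case False
      then have ins: "{k \<in> {..<Suc r}. k mod 3 \<noteq> 1} = insert r ?L" by (auto simp: less_Suc_eq)
      have filled: "j \<le> ?s r" if u: "u \<in> ?F ?L" and j: "j \<in> {1..n}" "u j \<in> ?L" for u j
      proof -
        let ?k = "u j"
        have k: "?k < r" "?k mod 3 \<noteq> 1" using j by auto
        have b: "j \<in> letter_bound n \<kappa> ?k" and c: "card {i \<in> {1..n}. u i = ?k} = \<kappa> ?k"
          using u j by (auto simp: fillings_def)
        \<comment> \<open>A letter k that occurs has multiplicity at least one, so even the bound
          with + 1 stays below the sum of the multiplicities up to and including k.\<close>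
        have "\<kappa> ?k \<noteq> 0" using c j(1) by (auto simp flip: c)
        moreover have "?s (Suc ?k) = ?s ?k + \<kappa> ?k" by simp
        moreover have "?k mod 3 = 0 \<or> ?k mod 3 = 2" using k(2) by presburger
        ultimately have "j \<le> ?s (Suc ?k)" using b by (auto simp: letter_bound_def)
        also have "\<dots> \<le> ?s r" using k(1) by (intro smono) simp
        finally show ?thesis .
      qed
      have sr: "?s r + \<kappa> r \<le> n" using smono[of "Suc r" M] Suc.prems n by simp
      have r3: "r mod 3 = 0 \<or> r mod 3 = 2" using False by presburger
      have "card (?F (insert r ?L)) = card (?F ?L) * ((card (letter_bound n \<kappa> r) - sum \<kappa> ?L) choose \<kappa> r)"
      proof (rule card_fillings_insert)
        fix u j assume "0 < \<kappa> r" "u \<in> ?F ?L" "j \<in> {1..n}" "u j \<in> ?L"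
        with filled[of u j] r3 show "j \<in> letter_bound n \<kappa> r" by (auto simp: letter_bound_def)
      qed (use Suc.prems lb in auto)
      also have "((card (letter_bound n \<kappa> r) - sum \<kappa> ?L) choose \<kappa> r) = letter_choices \<kappa> r"
      proof (cases "\<kappa> r = 0")
        case True
        then show ?thesis by (simp add: letter_choices_def)
      next
        case pos: False
        note sum_nf = sum_nonfree[of \<kappa> r]
        show ?thesis
        proof (cases "r mod 3 = 0")
          case True
          then have "letter_bound n \<kappa> r = {1..?s r + 1}" using sr pos by (auto simp: letter_bound_def)
          then have "card (letter_bound n \<kappa> r) - sum \<kappa> ?L = free_sum \<kappa> r + 1" using sum_nf by simp
          then show ?thesis using True by (simp add: letter_choices_def)
        next
          case r0: False
          then have r2: "r mod 3 = 2" using r3 by simp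
          then have "letter_bound n \<kappa> r = {1..<?s r + \<kappa> r}" using sr pos by (auto simp: letter_bound_def)
          then have "card (letter_bound n \<kappa> r) - sum \<kappa> ?L = free_sum \<kappa> r + \<kappa> r - 1" using sum_nf by simp
          then show ?thesis using r2 by (simp add: letter_choices_def)
        qed
      qed
      finally show ?thesis unfolding ins using Suc by simp
    qed
  qed
  let ?N = "{k \<in> {..<M}. k mod 3 \<noteq> 1}"
  have free: "card (?F (?N \<union> {k \<in> {r..<M}. k mod 3 = 1})) =
     (\<Prod>k\<in>?N \<union> {k \<in> {r..<M}. k mod 3 = 1}. letter_choices \<kappa> k)" if "r \<le> M" for r
    using that
  proof (induction rule: inc_induct)
    case base
    have "{k \<in> {M..<M}. k mod 3 = 1} = {}" by simp
    then show ?case using nonfree[of M] by (simp only: Un_empty_right order_refl)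
  next
    case (step r)
    let ?L = "?N \<union> {k \<in> {Suc r..<M}. k mod 3 = 1}"
    show ?case
    proof (cases "r mod 3 = 1")
      case False
      then have "{k \<in> {r..<M}. k mod 3 = 1} = {k \<in> {Suc r..<M}. k mod 3 = 1}" by (auto simp: Suc_le_eq le_less)
      then show ?thesis using step by simp
    next
      case True
      then have ins: "?N \<union> {k \<in> {r..<M}. k mod 3 = 1} = insert r ?L"
        using step.hyps by (auto simp: Suc_le_eq le_less)
      have b: "letter_bound n \<kappa> r = {1..n}" using True by (auto simp: letter_bound_def)
      have "card (?F (insert r ?L)) = card (?F ?L) * ((card (letter_bound n \<kappa> r) - sum \<kappa> ?L) choose \<kappa> r)"
        by (rule card_fillings_insert) (use step.hyps True b in auto)
      also have "card (letter_bound n \<kappa> r) - sum \<kappa> ?L = free_sum \<kappa> (Suc r)"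
      proof -
        have "{..<M} = ?L \<union> {k \<in> {..<Suc r}. k mod 3 = 1}" using step.hyps by auto
        then have "n = sum \<kappa> (?L \<union> {k \<in> {..<Suc r}. k mod 3 = 1})" using n by metis
        also have "\<dots> = sum \<kappa> ?L + free_sum \<kappa> (Suc r)"
          unfolding free_sum_def by (rule sum.union_disjoint) auto
        finally show ?thesis using b by simp
      qed
      also have "free_sum \<kappa> (Suc r) choose \<kappa> r = letter_choices \<kappa> r" using True by (simp add: letter_choices_def)
      finally show ?thesis unfolding ins using step.IH True step.hyps by (simp add: mult.commute)
    qed
  qed
  have "?N \<union> {k \<in> {0..<M}. k mod 3 = 1} = {..<M}" by auto
  then show ?thesis using free[of 0] by simp
qed

lemma signed_words_content:
  assumes n: "sum \<kappa> {..<3 * N} = n" and z: "\<And>k. k \<ge> 3 * N \<Longrightarrow> \<kappa> k = 0"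
  shows "{v \<in> signed_words n N. word_content n v = \<kappa>} = fillings n (letter_bound n \<kappa>) \<kappa> (3 * N) {..<3 * N}"
proof (intro equalityI subsetI)
  have less: "word_less n v r = sum \<kappa> {..<r}" if "\<And>l. l < r \<Longrightarrow> card {j \<in> {1..n}. v j = l} = \<kappa> l" for v r
    using card_filled[of "{..<r}" n v \<kappa>] that by (simp add: word_less_def)
  {
    fix v assume v: "v \<in> {v \<in> signed_words n N. word_content n v = \<kappa>}"
    have c: "card {j \<in> {1..n}. v j = l} = \<kappa> l" for l using v by (auto simp: word_content_def)
    show "v \<in> fillings n (letter_bound n \<kappa>) \<kappa> (3 * N) {..<3 * N}"
      using v c less[of _ v] by (auto simp: fillings_def signed_words_def letter_bound_def PiE_def Pi_def)
  next
    fix u assume u: "u \<in> fillings n (letter_bound n \<kappa>) \<kappa> (3 * N) {..<3 * N}"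
    have c: "card {j \<in> {1..n}. u j = l} = \<kappa> l" if "l < 3 * N" for l using u that by (auto simp: fillings_def)
    \<comment> \<open>The multiplicities add up to n, so no position is left empty.\<close>
    have "card {j \<in> {1..n}. u j \<in> {..<3 * N}} = card {1..n}"
      using card_filled[of "{..<3 * N}" n u \<kappa>] c n by simp
    then have "{j \<in> {1..n}. u j \<in> {..<3 * N}} = {1..n}" by (intro card_subset_eq) auto
    then have in3: "u j < 3 * N" if "j \<in> {1..n}" for j using that by blast
    have uE: "u \<in> {1..n} \<rightarrow>\<^sub>E {..<3 * N}" using u in3 by (auto simp: fillings_def PiE_def)
    have "word_content n u = \<kappa>"
    proof
      fix r show "word_content n u r = \<kappa> r"
      proof (cases "r < 3 * N")
        case False
        then have "{j \<in> {1..n}. u j = r} = {}" using in3 by auto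
        then show ?thesis using z[of r] False unfolding word_content_def by (metis card.empty not_less)
      qed (simp only: c word_content_def)
    qed
    moreover have "(u j mod 3 = 0 \<longrightarrow> j \<le> word_less n u (u j) + 1) \<and> (u j mod 3 = 2 \<longrightarrow> j < word_less n u (Suc (u j)))"
      if j: "j \<in> {1..n}" for j
    proof -
      have "j \<in> letter_bound n \<kappa> (u j)" using u in3[OF j] j by (auto simp: fillings_def)
      moreover have "word_less n u (u j) = sum \<kappa> {..<u j}" "word_less n u (Suc (u j)) = sum \<kappa> {..<Suc (u j)}"
        by (rule less, rule c, use in3[OF j] in linarith)+
      ultimately show ?thesis by (simp add: letter_bound_def)
    qed
    ultimately show "u \<in> {v \<in> signed_words n N. word_content n v = \<kappa>}"
      using uE by (simp add: signed_words_def)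
  }
qed

definition contents :: "nat \<Rightarrow> nat \<Rightarrow> (nat \<Rightarrow> nat) set" where
  "contents M n = {\<kappa>. (\<forall>k\<ge>M. \<kappa> k = 0) \<and> sum \<kappa> {..<M} = n}"

lemma finite_contents [simp]: "finite (contents M n)"
proof (rule finite_subset)
  show "contents M n \<subseteq> {\<kappa>. \<forall>k. (k \<in> {..<M} \<longrightarrow> \<kappa> k \<in> {..n}) \<and> (k \<notin> {..<M} \<longrightarrow> \<kappa> k = 0)}"
    by (auto simp: contents_def intro: member_le_sum)
  show "finite {\<kappa>. \<forall>k. (k \<in> {..<M} \<longrightarrow> \<kappa> k \<in> {..n}) \<and> (k \<notin> {..<M} \<longrightarrow> \<kappa> k = (0::nat))}"
    by (rule finite_set_of_finite_funs) auto
qed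

definition content_weight :: "(nat \<Rightarrow> 'a::comm_ring_1) \<Rightarrow> nat \<Rightarrow> (nat \<Rightarrow> nat) \<Rightarrow> 'a" where
  "content_weight y M \<kappa> = (\<Prod>r<M. y r ^ \<kappa> r * of_nat (letter_choices \<kappa> r))"

lemma sum_signed_words_eq_contents:
  fixes y :: "nat \<Rightarrow> 'a::comm_ring_1"
  shows "(\<Sum>v\<in>signed_words n N. \<Prod>j=1..n. y (v j)) = (\<Sum>\<kappa>\<in>contents (3 * N) n. content_weight y (3 * N) \<kappa>)"
proof -
  let ?M = "3 * N"
  have prod: "(\<Prod>j=1..n. y (v j)) = (\<Prod>r<?M. y r ^ word_content n v r)" if v: "v \<in> signed_words n N" for v
  proof -
    have "(\<Prod>j=1..n. y (v j)) = (\<Prod>r<?M. \<Prod>j\<in>{j \<in> {1..n}. v j = r}. y (v j))"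
      by (rule prod.group[symmetric]) (use v in \<open>auto simp: signed_words_def\<close>)
    also have "\<dots> = (\<Prod>r<?M. y r ^ word_content n v r)" by (intro prod.cong) (auto simp: word_content_def)
    finally show ?thesis .
  qed
  have img: "word_content n ` signed_words n N \<subseteq> contents ?M n"
  proof safe
    fix v assume v: "v \<in> signed_words n N"
    have in3: "v j < ?M" if "j \<in> {1..n}" for j using v that by (auto simp: signed_words_def)
    have "{j \<in> {1..n}. v j \<in> {..<?M}} = {1..n}" using in3 by auto
    then have "sum (word_content n v) {..<?M} = n"
      using card_filled[of "{..<?M}" n v "word_content n v"] by (simp add: word_content_def)
    moreover have "word_content n v k = 0" if "k \<ge> ?M" for k
    proof -
      have "{j \<in> {1..n}. v j = k} = {}" using in3 that by force
      then show ?thesis unfolding word_content_def by (simp only: card.empty)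
    qed
    ultimately show "word_content n v \<in> contents ?M n" by (simp add: contents_def)
  qed
  have "(\<Sum>v\<in>signed_words n N. \<Prod>j=1..n. y (v j)) =
     (\<Sum>\<kappa>\<in>contents ?M n. \<Sum>v\<in>{v \<in> signed_words n N. word_content n v = \<kappa>}. \<Prod>j=1..n. y (v j))"
    by (rule sum.group[symmetric]) (use img in auto)
  also have "\<dots> = (\<Sum>\<kappa>\<in>contents ?M n. content_weight y ?M \<kappa>)"
  proof (rule sum.cong[OF refl])
    fix \<kappa> assume \<kappa>: "\<kappa> \<in> contents ?M n"
    have "(\<Sum>v\<in>{v \<in> signed_words n N. word_content n v = \<kappa>}. \<Prod>j=1..n. y (v j)) =
      (\<Sum>v\<in>{v \<in> signed_words n N. word_content n v = \<kappa>}. \<Prod>r<?M. y r ^ \<kappa> r)"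
      by (intro sum.cong refl) (use prod in auto)
    also have "\<dots> = of_nat (\<Prod>r<?M. letter_choices \<kappa> r) * (\<Prod>r<?M. y r ^ \<kappa> r)"
      using \<kappa> signed_words_content[of \<kappa> N n] card_fillings_all[of \<kappa> ?M n] by (simp add: contents_def)
    also have "\<dots> = content_weight y ?M \<kappa>"
      by (simp add: content_weight_def prod.distrib mult.commute)
    finally show "(\<Sum>v\<in>{v \<in> signed_words n N. word_content n v = \<kappa>}. \<Prod>j=1..n. y (v j)) = content_weight y ?M \<kappa>" .
  qed
  finally show ?thesis .
qed

section \<open>Generating functions\<close>

unbundle fps_syntax

definition fps_geometric :: "'a::comm_ring_1 \<Rightarrow> 'a fps" where
  "fps_geometric c = Abs_fps (\<lambda>n. c ^ n)"

lemma fps_geometric_nth [simp]: "fps_geometric c $ n = c ^ n"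
  by (simp add: fps_geometric_def)

lemma fps_geometric_mult: "fps_geometric c * (1 - fps_const c * fps_X) = 1"
proof -
  have "fps_geometric c = 1 + fps_const c * (fps_X * fps_geometric c)"
  proof (rule fps_ext)
    fix n show "fps_geometric c $ n = (1 + fps_const c * (fps_X * fps_geometric c)) $ n"
      by (cases n) (simp_all add: fps_X_mult_nth)
  qed
  then show ?thesis by (simp add: algebra_simps)
qed

lemma fps_linear_power_nth:
  fixes y :: "'a::comm_ring_1"
  shows "((1 + fps_const y * fps_X) ^ m) $ c = of_nat (m choose c) * y ^ c"
proof (induction m arbitrary: c)
  case 0
  then show ?case by (cases c) auto
next
  case (Suc m)
  have "(1 + fps_const y * fps_X) ^ Suc m = (1 + fps_const y * fps_X) ^ m + fps_const y * (fps_X * (1 + fps_const y * fps_X) ^ m)"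
    by (simp add: algebra_simps)
  then show ?case using Suc by (cases c) (simp_all add: fps_X_mult_nth algebra_simps)
qed

text \<open>The induction step is the hockey-stick identity. For f = 0 the truncated difference
  gives 1 at c = 0 and 0 elsewhere, the same convention as in \<open>letter_choices\<close>.\<close>

lemma fps_geometric_power_nth:
  fixes y :: "'a::comm_ring_1"
  shows "(fps_geometric y ^ f) $ c = of_nat ((f + c - 1) choose c) * y ^ c"
proof (induction f arbitrary: c)
  case 0
  then show ?case by (cases c) (auto simp: binomial_eq_0)
next
  case (Suc f)
  have "(fps_geometric y ^ Suc f) $ c = (\<Sum>i\<le>c. (fps_geometric y ^ f) $ i * y ^ (c - i))"
    by (simp only: power_Suc2 fps_mult_nth fps_geometric_nth atLeast0AtMost)
  also have "\<dots> = (\<Sum>i\<le>c. of_nat ((f + i - 1) choose i) * y ^ c)"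
  proof (rule sum.cong[OF refl])
    fix i assume "i \<in> {..c}"
    then have "y ^ i * y ^ (c - i) = y ^ c" by (simp flip: power_add)
    then show "(fps_geometric y ^ f) $ i * y ^ (c - i) = of_nat ((f + i - 1) choose i) * y ^ c"
      unfolding Suc by (simp only: mult.assoc)
  qed
  also have "\<dots> = of_nat (\<Sum>i\<le>c. (f + i - 1) choose i) * y ^ c" by (simp add: sum_distrib_right)
  also have "(\<Sum>i\<le>c. (f + i - 1) choose i) = (Suc f + c - 1) choose c"
  proof (cases f)
    case 0
    have "(\<Sum>i\<le>c. (0 + i - 1) choose i) = (\<Sum>i\<le>c. if i = 0 then 1 else 0)"
      by (intro sum.cong refl) (auto simp: binomial_eq_0)
    then show ?thesis using 0 by simp
  next
    case (Suc g)
    then show ?thesis using sum_choose_lower[of g c] by simp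
  qed
  finally show ?case .
qed

text \<open>The number of choices for the next letter depends on the smaller letters only through
  the number f of free ones. Keeping f as a parameter therefore allows a recursion on the
  alphabet.\<close>

definition content_gf :: "(nat \<Rightarrow> 'a::comm_ring_1) \<Rightarrow> nat \<Rightarrow> nat \<Rightarrow> 'a fps" where
  "content_gf y M f = Abs_fps (\<lambda>n. \<Sum>\<kappa>\<in>contents M n. if free_sum \<kappa> M = f then content_weight y M \<kappa> else 0)"

lemma content_gf_nth:
  "content_gf y M f $ n = (\<Sum>\<kappa>\<in>contents M n. if free_sum \<kappa> M = f then content_weight y M \<kappa> else 0)"
  by (simp add: content_gf_def)

lemma sum_contents_Suc:
  fixes h :: "(nat \<Rightarrow> nat) \<Rightarrow> 'a::comm_ring_1"
  shows "(\<Sum>\<kappa>\<in>contents (Suc M) n. h \<kappa>) = (\<Sum>c\<le>n. \<Sum>\<kappa>\<in>contents M (n - c). h (\<kappa>(M := c)))"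
proof -
  have upd: "sum (\<kappa>(M := c)) {..<M} = sum \<kappa> {..<M}" for \<kappa> :: "nat \<Rightarrow> nat" and c by (intro sum.cong) auto
  have "(\<Sum>c\<le>n. \<Sum>\<kappa>\<in>contents M (n - c). h (\<kappa>(M := c))) = (\<Sum>(c, \<kappa>)\<in>Sigma {..n} (\<lambda>c. contents M (n - c)). h (\<kappa>(M := c)))"
    by (rule sum.Sigma) auto
  also have "\<dots> = (\<Sum>\<kappa>\<in>contents (Suc M) n. h \<kappa>)"
    by (rule sum.reindex_bij_witness[where i = "\<lambda>\<kappa>. (\<kappa> M, \<kappa>(M := 0))" and j = "\<lambda>(c, \<kappa>). \<kappa>(M := c)"])
      (auto simp: contents_def upd fun_eq_iff)
  finally show ?thesis by simp
qed

lemma free_sum_upd: "r \<le> M \<Longrightarrow> free_sum (\<kappa>(M := c)) r = free_sum \<kappa> r"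
  unfolding free_sum_def by (intro sum.cong) auto

lemma content_weight_upd:
  "content_weight y (Suc M) (\<kappa>(M := c)) =
     content_weight y M \<kappa> * (y M ^ c * of_nat (letter_choices (\<kappa>(M := c)) M))"
proof -
  have "letter_choices (\<kappa>(M := c)) r = letter_choices \<kappa> r" if "r < M" for r
    using that by (simp add: letter_choices_def free_sum_upd)
  then show ?thesis by (simp add: content_weight_def)
qed

text \<open>Sum over the number c of copies of the letter M. The binomials (f + 1 choose c) and (f +
  c - 1 choose c) are the coefficients of (1 + y z)^(f + 1) and (1 - y z)^(- f). A free letter
  leaves f - c free ones below it and yields a binomial convolution.\<close>

lemma content_gf_Suc:
  fixes y :: "nat \<Rightarrow> 'a::comm_ring_1"
  shows "M mod 3 = 0 \<Longrightarrow> content_gf y (Suc M) f = (1 + fps_const (y M) * fps_X) ^ Suc f * content_gf y M f"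
    and "M mod 3 = 1 \<Longrightarrow> content_gf y (Suc M) f =
      (\<Sum>c\<le>f. of_nat (f choose c) * (fps_const (y M) * fps_X) ^ c * content_gf y M (f - c))"
    and "M mod 3 = 2 \<Longrightarrow> content_gf y (Suc M) f = fps_geometric (y M) ^ f * content_gf y M f"
proof -
  have step: "content_gf y (Suc M) f $ n = (\<Sum>c\<le>n. \<Sum>\<kappa>\<in>contents M (n - c).
      if free_sum \<kappa> M + (if M mod 3 = 1 then c else 0) = f
      then content_weight y M \<kappa> * (y M ^ c * of_nat (letter_choices (\<kappa>(M := c)) M)) else 0)" for n
    unfolding content_gf_nth sum_contents_Suc
    by (simp add: free_sum_Suc free_sum_upd content_weight_upd cong: if_cong)
  {
    assume M: "M mod 3 = 0"
    show "content_gf y (Suc M) f = (1 + fps_const (y M) * fps_X) ^ Suc f * content_gf y M f"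
    proof (rule fps_ext)
      fix n
      have "content_gf y (Suc M) f $ n = (\<Sum>c\<le>n. ((1 + fps_const (y M) * fps_X) ^ Suc f) $ c * content_gf y M f $ (n - c))"
        unfolding step fps_linear_power_nth content_gf_nth[of y M] sum_distrib_left using M
        by (intro sum.cong refl) (auto simp: letter_choices_def free_sum_upd mult_ac)
      then show "content_gf y (Suc M) f $ n = ((1 + fps_const (y M) * fps_X) ^ Suc f * content_gf y M f) $ n"
        by (simp only: fps_mult_nth atLeast0AtMost)
    qed
  next
    assume M: "M mod 3 = 2"
    show "content_gf y (Suc M) f = fps_geometric (y M) ^ f * content_gf y M f"
    proof (rule fps_ext)
      fix n
      have "content_gf y (Suc M) f $ n = (\<Sum>c\<le>n. (fps_geometric (y M) ^ f) $ c * content_gf y M f $ (n - c))"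
        unfolding step fps_geometric_power_nth content_gf_nth[of y M] sum_distrib_left using M
        by (intro sum.cong refl) (auto simp: letter_choices_def free_sum_upd mult_ac)
      then show "content_gf y (Suc M) f $ n = (fps_geometric (y M) ^ f * content_gf y M f) $ n"
        by (simp only: fps_mult_nth atLeast0AtMost)
    qed
  next
    assume M: "M mod 3 = 1"
    show "content_gf y (Suc M) f = (\<Sum>c\<le>f. of_nat (f choose c) * (fps_const (y M) * fps_X) ^ c * content_gf y M (f - c))"
    proof (rule fps_ext)
      fix n
      let ?a = "\<lambda>c. of_nat (f choose c) * y M ^ c * content_gf y M (f - c) $ (n - c)"
      have "content_gf y (Suc M) f $ n = (\<Sum>c\<le>n. if c \<le> f then ?a c else 0)"
        unfolding step
      proof (rule sum.cong[OF refl])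
        fix c
        show "(\<Sum>\<kappa>\<in>contents M (n - c). if free_sum \<kappa> M + (if M mod 3 = 1 then c else 0) = f
            then content_weight y M \<kappa> * (y M ^ c * of_nat (letter_choices (\<kappa>(M := c)) M)) else 0) = (if c \<le> f then ?a c else 0)"
        proof (cases "c \<le> f")
          case True
          then have "free_sum \<kappa> M + c = f \<longleftrightarrow> free_sum \<kappa> M = f - c" for \<kappa> by auto
          then show ?thesis using M True unfolding content_gf_nth[of y M] sum_distrib_left
            by (auto simp: letter_choices_def free_sum_upd free_sum_Suc mult_ac intro!: sum.cong)
        next
          case False
          then show ?thesis using M by (auto intro!: sum.neutral)
        qed
      qed
      also have "\<dots> = (\<Sum>c\<in>{..n} \<inter> {..f}. ?a c)" by (simp only: sum.inter_restrict[OF finite_atMost] atMost_iff)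
      also have "\<dots> = (\<Sum>c\<in>{..f} \<inter> {..n}. ?a c)" by (simp only: Int_commute)
      also have "\<dots> = (\<Sum>c\<le>f. if c \<le> n then ?a c else 0)" by (simp only: sum.inter_restrict[OF finite_atMost] atMost_iff)
      also have "\<dots> = (\<Sum>c\<le>f. of_nat (f choose c) * (fps_const (y M) * fps_X) ^ c * content_gf y M (f - c)) $ n"
        unfolding fps_sum_nth
      proof (rule sum.cong[OF refl])
        fix c
        have "of_nat (f choose c) * (fps_const (y M) * fps_X) ^ c * content_gf y M (f - c) =
          fps_const (of_nat (f choose c) * y M ^ c) * (fps_X ^ c * content_gf y M (f - c))"
          by (simp add: power_mult_distrib fps_const_power fps_of_nat[symmetric] mult_ac fps_const_mult[symmetric] del: fps_const_mult)
        then show "(if c \<le> n then ?a c else 0) = (of_nat (f choose c) * (fps_const (y M) * fps_X) ^ c * content_gf y M (f - c)) $ n"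
          by (simp add: fps_X_power_mult_nth)
      qed
      finally show "content_gf y (Suc M) f $ n = (\<Sum>c\<le>f. of_nat (f choose c) * (fps_const (y M) * fps_X) ^ c * content_gf y M (f - c)) $ n" .
    qed
  }
qed

text \<open>
  The generating function of contents with \<open>f\<close> unbounded letters turns out to be \<open>gf_scale * gf_base ^ f\<close>.
\<close>

fun gf_scale :: "(nat \<Rightarrow> 'a::comm_ring_1) \<Rightarrow> nat \<Rightarrow> 'a fps" where
  "gf_scale y 0 = 1"
| "gf_scale y (Suc M) = (if M mod 3 = 0 then gf_scale y M * (1 + fps_const (y M) * fps_X) else gf_scale y M)"

fun gf_base :: "(nat \<Rightarrow> 'a::comm_ring_1) \<Rightarrow> nat \<Rightarrow> 'a fps" where
  "gf_base y 0 = 0"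
| "gf_base y (Suc M) =
     (if M mod 3 = 0 then gf_base y M * (1 + fps_const (y M) * fps_X)
      else if M mod 3 = 1 then gf_base y M + fps_const (y M) * fps_X
      else gf_base y M * fps_geometric (y M))"

text \<open>All three steps preserve the shape K * A^f: the factor (1 + y z)^(f + 1) multiplies both
  K and A by 1 + y z, the binomial theorem replaces A by A + y z, and the geometric factor goes into
  A. The start is 0^f, as the empty content has f = 0.\<close>

lemma content_gf_closed: "content_gf y M f = gf_scale y M * gf_base y M ^ f"
proof (induction M arbitrary: f)
  case 0
  have "contents 0 n = (if n = 0 then {\<lambda>_. 0} else {})" for n by (auto simp: contents_def)
  then show ?case by (intro fps_ext) (auto simp: content_gf_nth content_weight_def power_0_left)
next
  case (Suc M)
  consider "M mod 3 = 0" | "M mod 3 = 1" | "M mod 3 = 2" by linarith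
  then show ?case
  proof cases
    case 1
    then show ?thesis by (simp add: content_gf_Suc(1) Suc power_mult_distrib mult_ac)
  next
    case 2
    have "(gf_base y M + fps_const (y M) * fps_X) ^ f =
      (\<Sum>c\<le>f. of_nat (f choose c) * (fps_const (y M) * fps_X) ^ c * gf_base y M ^ (f - c))"
      unfolding add.commute[of "gf_base y M"] by (rule binomial_ring)
    then show ?thesis using 2 by (simp add: content_gf_Suc(2) Suc sum_distrib_left mult_ac)
  next
    case 3
    then show ?thesis by (simp add: content_gf_Suc(3) Suc power_mult_distrib mult_ac)
  qed
qed

lemma gf_base_nth_0: "gf_base y M $ 0 = 0"
  by (induction M) auto

definition total_gf :: "(nat \<Rightarrow> 'a::comm_ring_1) \<Rightarrow> nat \<Rightarrow> 'a fps" where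
  "total_gf y M = Abs_fps (\<lambda>n. \<Sum>\<kappa>\<in>contents M n. content_weight y M \<kappa>)"

lemma total_gf_mult: "total_gf y M * (1 - gf_base y M) = gf_scale y M"
proof -
  let ?K = "gf_scale y M" and ?A = "gf_base y M"
  have low: "(?K * ?A ^ f) $ i = 0" if "i < f" for f i
  proof -
    have "(?A ^ f) $ j = 0" if "j \<le> i" for j
      using startsby_zero_power_prefix[OF gf_base_nth_0[of y M], of f] that \<open>i < f\<close> by auto
    then show ?thesis unfolding fps_mult_nth by (intro sum.neutral) auto
  qed
  have total: "total_gf y M $ n = (\<Sum>f\<le>n. (?K * ?A ^ f) $ n)" for n
  proof -
    have "content_weight y M \<kappa> = (\<Sum>f\<le>n. if free_sum \<kappa> M = f then content_weight y M \<kappa> else 0)"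
      if "\<kappa> \<in> contents M n" for \<kappa>
    proof -
      have "free_sum \<kappa> M \<le> n" using that sum_nonfree[of \<kappa> M] by (simp add: contents_def)
      then show ?thesis by simp
    qed
    then have "total_gf y M $ n = (\<Sum>\<kappa>\<in>contents M n. \<Sum>f\<le>n. if free_sum \<kappa> M = f then content_weight y M \<kappa> else 0)"
      by (simp add: total_gf_def)
    also have "\<dots> = (\<Sum>f\<le>n. content_gf y M f $ n)"
      by (subst sum.swap) (simp add: content_gf_nth)
    finally show ?thesis by (simp only: content_gf_closed)
  qed
  show ?thesis
  proof (rule fps_ext)
    fix n
    \<comment> \<open>Since \<open>gf_base\<close> has no constant term, terms with f > n do not
      reach the coefficient n, and a finite geometric sum replaces the infinite one.\<close>
    define P where "P = (\<Sum>f\<le>n. ?K * ?A ^ f)"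
    have "total_gf y M $ i = P $ i" if "i \<le> n" for i
    proof -
      have "(\<Sum>f\<le>i. (?K * ?A ^ f) $ i) = (\<Sum>f\<le>n. (?K * ?A ^ f) $ i)"
        using that by (intro sum.mono_neutral_left) (auto simp: low)
      then show ?thesis by (simp only: total P_def fps_sum_nth)
    qed
    then have "(total_gf y M * (1 - ?A)) $ n = (P * (1 - ?A)) $ n" by (simp add: fps_mult_nth)
    also have "P * (1 - ?A) = ?K * ((1 - ?A) * (\<Sum>f\<le>n. ?A ^ f))"
      by (simp add: P_def mult_ac flip: sum_distrib_left)
    also have "\<dots> = ?K - ?K * ?A ^ Suc n" by (simp only: sum_gp_basic right_diff_distrib mult_1_right)
    also have "\<dots> $ n = ?K $ n" using low[of n "Suc n"] by (simp del: power_Suc)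
    finally show "(total_gf y M * (1 - ?A)) $ n = ?K $ n" .
  qed
qed

lemma total_gf_signed:
  fixes t :: "'a::comm_ring_1"
  shows "total_gf (signed_letter_weight t x) (3 * N) *
     ((\<Prod>b<N. fps_geometric (t * x b)) - fps_const t * (\<Prod>b<N. fps_geometric (x b))) = 1 - fps_const t"
proof -
  let ?y = "signed_letter_weight t x"
  let ?K = "\<lambda>N. gf_scale ?y (3 * N)" and ?A = "\<lambda>N. gf_base ?y (3 * N)"
  let ?E = "\<lambda>N. \<Prod>b<N. fps_geometric (x b)" and ?Et = "\<lambda>N. \<Prod>b<N. fps_geometric (t * x b)"
  let ?t = "fps_const t"
  have y: "?y (3 * b) = - (t * x b)" "?y (Suc (3 * b)) = t * x b" "?y (Suc (Suc (3 * b))) = x b" for b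
  proof -
    have "Suc (3 * b) mod 3 = 1" "Suc (3 * b) div 3 = b" "Suc (Suc (3 * b)) mod 3 = 2" "Suc (Suc (3 * b)) div 3 = b"
      by presburger+
    then show "?y (3 * b) = - (t * x b)" "?y (Suc (3 * b)) = t * x b" "?y (Suc (Suc (3 * b))) = x b"
      by (simp_all add: signed_letter_weight_def)
  qed
  have md: "3 * b mod 3 = 0" "Suc (3 * b) mod 3 = 1" "Suc (Suc (3 * b)) mod 3 = 2" for b :: nat by presburger+
  have S: "3 * Suc b = Suc (Suc (Suc (3 * b)))" for b by simp
  have neg: "1 + fps_const (- (t * x b)) * fps_X = 1 - fps_const (t * x b) * fps_X" for b
    by (simp flip: fps_const_neg)
  have K: "?K (Suc b) = ?K b * (1 - fps_const (t * x b) * fps_X)" for b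
    unfolding S gf_scale.simps y md neg by simp
  have A: "?A (Suc b) = (?A b * (1 - fps_const (t * x b) * fps_X) + fps_const (t * x b) * fps_X) * fps_geometric (x b)" for b
    unfolding S gf_base.simps y md neg by simp
  \<comment> \<open>Thus \<open>gf_scale\<close> is 1 / e(t z).\<close>
  have KE: "?K N * ?Et N = 1" for N
  proof (induction N)
    case (Suc N)
    have "?K (Suc N) * ?Et (Suc N) = (?K N * ?Et N) * (fps_geometric (t * x N) * (1 - fps_const (t * x N) * fps_X))"
      unfolding K by (simp add: mult_ac)
    then show ?case by (simp only: Suc fps_geometric_mult mult_1_right)
  qed simp
  have ring1: "(1 - T) * ((a * (1 - c) + c) * g) = ((1 - T) * a * (1 - c) + (1 - T) * c) * g" for T a c g :: "'a fps"
    by (simp add: algebra_simps)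
  have ring2: "((T * k * e - T) * (1 - T * c) + (1 - T) * (T * c)) * g = T * (k * (1 - T * c)) * (e * g) - T * (g * (1 - c))"
    for T k e c g :: "'a fps"
    by (simp add: algebra_simps)
  \<comment> \<open>One round of three letters maps A to (A (1 - t c) + t c) / (1 - c) with c = x_N
    z. Its fixed point - t / (1 - t) does not depend on c, so the deviation (1 - t) A + t, which
    starts as t, is merely multiplied by (1 - t c) / (1 - c), the growth factor of K E. The factor 1
    - t is kept because it need not be invertible.\<close>
  have AE: "(1 - ?t) * ?A N = ?t * ?K N * ?E N - ?t" for N
  proof (induction N)
    case (Suc N)
    let ?g = "fps_geometric (x N)" and ?c = "fps_const (x N) * fps_X"
    have tx: "fps_const (t * x N) * fps_X = ?t * ?c" by (simp add: mult.assoc flip: fps_const_mult)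
    have "(1 - ?t) * ?A (Suc N) = ((1 - ?t) * ?A N * (1 - ?t * ?c) + (1 - ?t) * (?t * ?c)) * ?g"
      unfolding A tx by (rule ring1)
    also have "\<dots> = ?t * (?K N * (1 - ?t * ?c)) * (?E N * ?g) - ?t * (?g * (1 - ?c))"
      unfolding Suc by (rule ring2)
    also have "\<dots> = ?t * ?K (Suc N) * ?E (Suc N) - ?t"
      unfolding K tx fps_geometric_mult by simp
    finally show ?case .
  qed simp
  let ?T = "total_gf ?y (3 * N)"
  have "(1 - ?t) * ?K N = ?T * ((1 - ?t) - (1 - ?t) * ?A N)"
    unfolding total_gf_mult[symmetric] by (simp add: algebra_simps)
  also have "\<dots> = ?T * (1 - ?t * ?K N * ?E N)" unfolding AE by simp
  finally have scaled: "(1 - ?t) * ?K N = ?T * (1 - ?t * ?K N * ?E N)" .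
  have "(1 - ?t) * (?K N * ?Et N) = (1 - ?t) * ?K N * ?Et N" by (simp only: mult.assoc)
  also have "\<dots> = ?T * (1 - ?t * ?K N * ?E N) * ?Et N" by (simp only: scaled)
  also have "\<dots> = ?T * (?Et N - ?t * ?E N * (?K N * ?Et N))" by (simp add: algebra_simps)
  finally show ?thesis by (simp add: KE)
qed

section \<open>Infinitely many letters\<close>

lemma prod_fps_geometric_scale:
  fixes t :: "'a::comm_ring_1" and x :: "nat \<Rightarrow> 'a"
  shows "(\<Prod>b<N. fps_geometric (t * x b)) $ m = t ^ m * (\<Prod>b<N. fps_geometric (x b)) $ m"
proof (induction N arbitrary: m)
  case 0
  then show ?case by (cases m) auto
next
  case (Suc N)
  have "(\<Prod>b<Suc N. fps_geometric (t * x b)) $ m = (\<Sum>i=0..m. t ^ m * ((\<Prod>b<N. fps_geometric (x b)) $ i * x N ^ (m - i)))"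
    unfolding prod.lessThan_Suc fps_mult_nth Suc
  proof (rule sum.cong[OF refl])
    fix i assume "i \<in> {0..m}"
    then have "t ^ m = t ^ i * t ^ (m - i)" by (simp flip: power_add)
    then show "t ^ i * (\<Prod>b<N. fps_geometric (x b)) $ i * fps_geometric (t * x N) $ (m - i) =
      t ^ m * ((\<Prod>b<N. fps_geometric (x b)) $ i * x N ^ (m - i))" by (simp add: power_mult_distrib mult_ac)
  qed
  then show ?case by (simp add: fps_mult_nth sum_distrib_left)
qed

text \<open>Euler's expansion of the product of all 1 / (1 - q^i z), coefficient by coefficient.
  Splitting off the factor i = 0 leaves the previous product at q z, that is, (1 - z) e_(N+1)(z) =
  e_N(q z), which is an affine recurrence in N.\<close>

lemma prod_fps_geometric_tendsto:
  fixes q :: real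
  assumes q: "0 < q" "q < 1"
  shows "(\<lambda>N. (\<Prod>i<N. fps_geometric (q ^ i)) $ m) \<longlonglongrightarrow> 1 / q_fact q m"
proof (induction m)
  case 0
  have "(\<Prod>i<N. fps_geometric (q ^ i)) $ 0 = 1" for N by (induction N) auto
  then show ?case by simp
next
  case (Suc m)
  let ?e = "\<lambda>N. \<Prod>i<N. fps_geometric (q ^ i)"
  have "?e (Suc N) $ Suc m = q ^ Suc m * ?e N $ Suc m + ?e (Suc N) $ m" for N
  proof -
    let ?g = "\<Prod>i<N. fps_geometric (q * q ^ i)"
    have e: "?e (Suc N) = ?g * fps_geometric 1" by (simp add: prod.lessThan_Suc_shift mult.commute del: prod.lessThan_Suc)
    show ?thesis unfolding e by (simp add: fps_mult_nth prod_fps_geometric_scale)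
  qed
  then have "(\<lambda>N. ?e N $ Suc m) \<longlonglongrightarrow> (1 / q_fact q m) / (1 - q ^ Suc m)"
    by (rule affine_recurrence_tendsto[OF _ _ _ LIMSEQ_Suc[OF Suc], rotated 2])
      (use q in \<open>auto simp: power_less_one_iff simp del: power_Suc\<close>)
  then show ?case by (simp only: q_fact_Suc divide_divide_eq_left)
qed

lemma eulerian_A_derangements:
  "eulerian_A n t 0 q = (\<Sum>\<sigma>\<in>derangements n. t ^ perm_exc n \<sigma> * q ^ (perm_maj n \<sigma> - perm_exc n \<sigma>))"
  unfolding eulerian_A_def
proof (rule sum.mono_neutral_cong_right)
  show "finite {\<sigma>. \<sigma> permutes {1..n}}" by (simp add: finite_permutations)
  have fix_iff: "perm_fix n \<sigma> = 0 \<longleftrightarrow> (\<forall>i\<in>{1..n}. \<sigma> i \<noteq> i)" for \<sigma> by (auto simp: perm_fix_def)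
  show "\<forall>\<sigma>\<in>{\<sigma>. \<sigma> permutes {1..n}} - derangements n. t ^ perm_exc n \<sigma> * 0 ^ perm_fix n \<sigma> * q ^ (perm_maj n \<sigma> - perm_exc n \<sigma>) = 0"
  proof
    fix \<sigma> assume "\<sigma> \<in> {\<sigma>. \<sigma> permutes {1..n}} - derangements n"
    then have "perm_fix n \<sigma> \<noteq> 0" unfolding fix_iff by (auto simp: derangements_def)
    then show "t ^ perm_exc n \<sigma> * 0 ^ perm_fix n \<sigma> * q ^ (perm_maj n \<sigma> - perm_exc n \<sigma>) = 0" by (simp add: power_0_left)
  qed
  show "t ^ perm_exc n \<sigma> * 0 ^ perm_fix n \<sigma> * q ^ (perm_maj n \<sigma> - perm_exc n \<sigma>) = t ^ perm_exc n \<sigma> * q ^ (perm_maj n \<sigma> - perm_exc n \<sigma>)"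
    if "\<sigma> \<in> derangements n" for \<sigma> using that fix_iff[of \<sigma>] by (auto simp: derangements_def power_0_left)
qed (auto simp: derangements_def)

lemma eulerian_A_recurrence:
  fixes t q :: real
  assumes q: "0 < q" "q < 1" and n: "n \<ge> 1"
  shows "(\<Sum>m\<le>n. (t ^ m - t) * eulerian_A (n - m) t 0 q / (q_fact q m * q_fact q (n - m))) = 0"
proof -
  let ?x = "\<lambda>N b. q ^ (N - Suc b)"
  let ?F = "\<lambda>N k. \<Sum>\<sigma>\<in>derangements k. t ^ perm_exc k \<sigma> * chain_sum (?x N) k N (dex_set k \<sigma>)"
  let ?e = "\<lambda>N m. (\<Prod>i<N. fps_geometric (q ^ i)) $ m"
  have F: "?F N k = total_gf (signed_letter_weight t (?x N)) (3 * N) $ k" for N k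
    by (simp only: sum_chain_funs_eq_words sum_exc_words_eq_signed sum_signed_words_eq_contents total_gf_def fps_nth_Abs_fps)
  have zero: "(\<Sum>m\<le>n. (t ^ m - t) * ?e N m * ?F N (n - m)) = 0" for N
  proof -
    \<comment> \<open>The product of \<open>?G\<close> with the total generating function is 1 - t,
      which has no term in z^n for n >= 1. Reversing the order of the factors turns the weights q^(N
      - 1 - b) into q^i in \<open>?G\<close>.\<close>
    let ?G = "(\<Prod>b<N. fps_geometric (t * ?x N b)) - fps_const t * (\<Prod>b<N. fps_geometric (?x N b))"
    have e: "(\<Prod>b<N. fps_geometric (?x N b)) = (\<Prod>i<N. fps_geometric (q ^ i))"
      by (rule prod.nat_diff_reindex)
    have "?G $ m = (t ^ m - t) * ?e N m" for m
      by (simp add: prod_fps_geometric_scale e algebra_simps)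
    then have "(\<Sum>m\<le>n. (t ^ m - t) * ?e N m * ?F N (n - m)) = (?G * total_gf (signed_letter_weight t (?x N)) (3 * N)) $ n"
      unfolding F fps_mult_nth by (simp add: atLeast0AtMost)
    also have "\<dots> = (1 - fps_const t) $ n" using total_gf_signed[of t "?x N" N] by (simp add: mult.commute)
    finally show ?thesis using n by simp
  qed
  have Flim: "(\<lambda>N. ?F N k) \<longlonglongrightarrow> eulerian_A k t 0 q / q_fact q k" for k
  proof -
    have "(\<lambda>N. ?F N k) \<longlonglongrightarrow> (\<Sum>\<sigma>\<in>derangements k. t ^ perm_exc k \<sigma> * (q ^ (perm_maj k \<sigma> - perm_exc k \<sigma>) / q_fact q k))"
    proof (intro tendsto_sum tendsto_mult tendsto_const)
      fix \<sigma> assume "\<sigma> \<in> derangements k"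
      then have s: "\<Sum>(dex_set k \<sigma>) = perm_maj k \<sigma> - perm_exc k \<sigma>"
        using sum_dex_set[of \<sigma> k] by (auto simp: derangements_def)
      have d: "0 \<notin> dex_set k \<sigma>" "finite (dex_set k \<sigma>)" "{i \<in> dex_set k \<sigma>. i < k} = dex_set k \<sigma>"
        by (auto simp: dex_set_def)
      show "(\<lambda>N. chain_sum (?x N) k N (dex_set k \<sigma>)) \<longlonglongrightarrow> q ^ (perm_maj k \<sigma> - perm_exc k \<sigma>) / q_fact q k"
        using chain_sum_tendsto[OF q d(1,2), of k] by (simp only: d(3) s)
    qed
    then show ?thesis by (simp add: eulerian_A_derangements sum_divide_distrib)
  qed
  have "(\<lambda>N. \<Sum>m\<le>n. (t ^ m - t) * ?e N m * ?F N (n - m)) \<longlonglongrightarrow>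
    (\<Sum>m\<le>n. (t ^ m - t) * (1 / q_fact q m) * (eulerian_A (n - m) t 0 q / q_fact q (n - m)))"
    by (intro tendsto_sum tendsto_mult tendsto_const Flim prod_fps_geometric_tendsto q)
  then have "(\<Sum>m\<le>n. (t ^ m - t) * (1 / q_fact q m) * (eulerian_A (n - m) t 0 q / q_fact q (n - m))) = 0"
    unfolding zero by (simp add: LIMSEQ_const_iff)
  then show ?thesis by simp
qed

section \<open>Transfer to commutative rings\<close>

text \<open>Collecting equal monomials gives integer coefficients \<open>C\<close>. Over the reals
  they vanish, since a polynomial in t, and then each of its coefficients as a polynomial in q, has
  infinitely many roots. Vanishing integers stay zero in every ring.\<close>

lemma bivariate_identity_transfer:
  fixes a b :: "'i \<Rightarrow> nat" and c :: "'i \<Rightarrow> int" and t q :: "'a::comm_ring_1"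
  assumes fin: "finite I"
    and real: "\<And>t q :: real. 1 < t \<Longrightarrow> 0 < q \<Longrightarrow> q < 1 \<Longrightarrow> (\<Sum>i\<in>I. of_int (c i) * t ^ a i * q ^ b i) = 0"
  shows "(\<Sum>i\<in>I. of_int (c i) * t ^ a i * q ^ b i) = 0"
proof -
  define M where "M = (\<Sum>i\<in>I. a i + b i)"
  have le: "a i \<le> M" "b i \<le> M" if "i \<in> I" for i
    using member_le_sum[OF that, of "\<lambda>i. a i + b i"] fin unfolding M_def by auto
  define C where "C = (\<lambda>\<alpha> \<beta>. \<Sum>i\<in>{i \<in> I. (a i, b i) = (\<alpha>, \<beta>)}. c i)"
  have expand: "(\<Sum>i\<in>I. of_int (c i) * t ^ a i * q ^ b i) = (\<Sum>\<alpha>\<le>M. (\<Sum>\<beta>\<le>M. of_int (C \<alpha> \<beta>) * q ^ \<beta>) * t ^ \<alpha>)"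
    for t q :: "'b::comm_ring_1"
  proof -
    have "(\<Sum>i\<in>I. of_int (c i) * t ^ a i * q ^ b i) =
      (\<Sum>p\<in>{..M} \<times> {..M}. \<Sum>i\<in>{i \<in> I. (a i, b i) = p}. of_int (c i) * t ^ a i * q ^ b i)"
      by (rule sum.group[symmetric]) (use fin le in auto)
    also have "\<dots> = (\<Sum>(\<alpha>, \<beta>)\<in>{..M} \<times> {..M}. of_int (C \<alpha> \<beta>) * q ^ \<beta> * t ^ \<alpha>)"
      by (intro sum.cong refl) (auto simp: C_def sum_distrib_right sum_distrib_left mult_ac intro!: sum.cong)
    also have "\<dots> = (\<Sum>\<alpha>\<le>M. (\<Sum>\<beta>\<le>M. of_int (C \<alpha> \<beta>) * q ^ \<beta>) * t ^ \<alpha>)"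
      by (simp add: sum.cartesian_product sum_distrib_right)
    finally show ?thesis .
  qed
  have inner: "(\<Sum>\<beta>\<le>M. real_of_int (C \<alpha> \<beta>) * q ^ \<beta>) = 0" if q: "0 < q" "q < 1" and "\<alpha> \<le> M" for q \<alpha>
  proof -
    have "{1::real<..} \<subseteq> {t. (\<Sum>\<alpha>\<le>M. (\<Sum>\<beta>\<le>M. real_of_int (C \<alpha> \<beta>) * q ^ \<beta>) * t ^ \<alpha>) = 0}"
      using real[OF _ q] by (auto simp: expand)
    then have "infinite {t. (\<Sum>\<alpha>\<le>M. (\<Sum>\<beta>\<le>M. real_of_int (C \<alpha> \<beta>) * q ^ \<beta>) * t ^ \<alpha>) = 0}"
      using infinite_Ioi infinite_super by blast
    then show ?thesis using \<open>\<alpha> \<le> M\<close> unfolding polyfun_finite_roots by blast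
  qed
  have "C \<alpha> \<beta> = 0" if "\<alpha> \<le> M" "\<beta> \<le> M" for \<alpha> \<beta>
  proof -
    have "{0::real<..<1} \<subseteq> {q. (\<Sum>\<beta>\<le>M. real_of_int (C \<alpha> \<beta>) * q ^ \<beta>) = 0}"
      using inner that by auto
    then have "infinite {q. (\<Sum>\<beta>\<le>M. real_of_int (C \<alpha> \<beta>) * q ^ \<beta>) = 0}"
      using infinite_Ioo[OF zero_less_one[where 'a = real]] infinite_super by blast
    then have "real_of_int (C \<alpha> \<beta>) = 0" using that unfolding polyfun_finite_roots by blast
    then show ?thesis by simp
  qed
  then show ?thesis unfolding expand by simp
qed

theorem theorem1p5:
  fixes n :: nat and t q :: "'a :: comm_ring_1"
  assumes "n \<ge> 1"
  shows "eulerian_A n t 0 q =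
    (\<Sum>k = 1..n div 2. (\<Sum>\<sigma> \<in> D_tilde_set n k. q ^ perm_inv n \<sigma>) * t ^ k * (1 + t) ^ (n - 2 * k))"
proof -
  let ?R = "\<lambda>t q. \<Sum>k = 1..n div 2. (\<Sum>\<sigma> \<in> D_tilde_set n k. q ^ perm_inv n \<sigma>) * t ^ k * (1 + t) ^ (n - 2 * k)"
  \<comment> \<open>In this range t differs from 1 and \<open>q_fact\<close> is nonzero, as
    uniqueness requires, and the limits exist; both parameters still take infinitely many values, as
    the transfer requires.\<close>
  have real: "eulerian_A n t 0 q = ?R t q" if "1 < t" "0 < q" "q < 1" for t q :: real
  proof -
    have "run_sum t q {1..n} = eulerian_A (card {1..n}) t 0 q"
    proof (rule run_sum_unique)
      show "q_fact q k \<noteq> 0" for k using q_fact_pos[of q k] that by simp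
      have "{\<sigma>. \<sigma> permutes {1..0::nat}} = {id}" by auto
      then show "eulerian_A 0 t 0 q = 1" by (simp add: eulerian_A_def perm_exc_def perm_fix_def perm_maj_def)
    qed (use that eulerian_A_recurrence in auto)
    then show ?thesis using run_sum_eq_D_tilde[OF assms, of t q] by simp
  qed
  \<comment> \<open>The difference of the two sides as one family of monomials: one for each
    derangement and, with a negative binomial coefficient, one for each k, \<sigma> and each power
    t^j in the expansion of (1 + t)^(n - 2 k).\<close>
  define J where "J = Sigma {1..n div 2} (\<lambda>k. D_tilde_set n k \<times> {..n - 2 * k})"
  have finD: "finite (D_tilde_set n k)" for k
    by (rule finite_subset[OF _ finite_permutations[of "{1..n}"]]) (auto simp: D_tilde_set_def D_set_def)
  have finJ: "finite J" unfolding J_def using finD by auto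
  let ?c = "case_sum (\<lambda>\<sigma>. 1) (\<lambda>(k, \<sigma>, j). - int ((n - 2 * k) choose j))"
  let ?a = "case_sum (\<lambda>\<sigma>. perm_exc n \<sigma>) (\<lambda>(k, \<sigma>, j). k + j)"
  let ?b = "case_sum (\<lambda>\<sigma>. perm_maj n \<sigma> - perm_exc n \<sigma>) (\<lambda>(k, \<sigma>, j). perm_inv n \<sigma>)"
  have expand: "(\<Sum>i\<in>derangements n <+> J. of_int (?c i) * t ^ ?a i * q ^ ?b i) = eulerian_A n t 0 q - ?R t q"
    for t q :: "'b::comm_ring_1"
  proof -
    have "?R t q = (\<Sum>k = 1..n div 2. \<Sum>\<sigma>\<in>D_tilde_set n k. \<Sum>j\<le>n - 2 * k. of_nat ((n - 2 * k) choose j) * t ^ (k + j) * q ^ perm_inv n \<sigma>)"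
    proof (rule sum.cong[OF refl])
      fix k
      have e: "t ^ k * (1 + t) ^ (n - 2 * k) = (\<Sum>j\<le>n - 2 * k. of_nat ((n - 2 * k) choose j) * t ^ (k + j))"
        using binomial_ring[of t 1 "n - 2 * k"] by (simp add: add.commute sum_distrib_left power_add mult_ac)
      show "(\<Sum>\<sigma>\<in>D_tilde_set n k. q ^ perm_inv n \<sigma>) * t ^ k * (1 + t) ^ (n - 2 * k) =
        (\<Sum>\<sigma>\<in>D_tilde_set n k. \<Sum>j\<le>n - 2 * k. of_nat ((n - 2 * k) choose j) * t ^ (k + j) * q ^ perm_inv n \<sigma>)"
        unfolding mult.assoc[of _ "t ^ k"] e sum_distrib_right[of _ "D_tilde_set n k"] sum_distrib_left
        by (simp only: mult.commute[of "q ^ _"])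
    qed
    also have "\<dots> = (\<Sum>(k, \<sigma>, j)\<in>J. of_nat ((n - 2 * k) choose j) * t ^ (k + j) * q ^ perm_inv n \<sigma>)"
      unfolding J_def sum.cartesian_product by (subst sum.Sigma) (use finD in auto)
    finally show ?thesis
      by (simp add: sum.Plus finJ eulerian_A_derangements case_prod_beta sum_negf)
  qed
  have "(\<Sum>i\<in>derangements n <+> J. of_int (?c i) * t ^ ?a i * q ^ ?b i) = 0"
  proof (rule bivariate_identity_transfer)
    show "finite (derangements n <+> J)" using finJ by simp
  next
    fix t q :: real assume "1 < t" "0 < q" "q < 1"
    then show "(\<Sum>i\<in>derangements n <+> J. of_int (?c i) * t ^ ?a i * q ^ ?b i) = 0"
      unfolding expand using real by simp
  qed
  then show ?thesis unfolding expand by simp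
qed

end
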